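(* Let $f_k\in N^1X$ and suppose that $g_k\in X$ is an $X$-weak upper gradient of $f_k$, $k\in\mathbb N$. Assume further that $f_k\to f$ in $X$ and $g_k\to g$ in $X$ as $k\to\infty$, where $g$ is non-negative. Then there is a function $\tilde f=f$ $\mu$-a.e. such that $g$ is an $X$-weak upper gradient of $\tilde f$, and thus $\tilde f\in N^1X$. Furthermore, there is a subsequence $\{f_{k_j}\}_{j=1}^\infty$ such that $f_{k_j}\to\tilde f$ q.e. as $j\to\infty$. If either $f\in N^1X$ or there is a subsequence $\{f_{k_j}\}_{j=1}^\infty$ such that $f_{k_j}\to f$ q.e. as $j\to\infty$, then we may choose $\tilde f=f$.
   Context: Setting: $\mathcal P=(\mathcal P,d,\mu)$ is a metric space equipped with a $\sigma$-finite Borel regular measure $\mu$ (all Borel sets are $\mu$-measurable, and each $\mu$-measurable set $A$ is contained in a Borel set $D$ with $\mu(D)=\mu(A)$) such that every ball has finite positive measure. $\mathcal M(\mathcal P,\mu)$ is the set of all extended real-valued $\mu$-measurable functions on $\mathcal P$. $X$ is a quasi-Banach function lattice: there is a functional $\|\cdot\|_X:\mathcal M(\mathcal P,\mu)\to[0,\infty]$ with (P0) $X=\{u\in\mathcal M(\mathcal P,\mu):\|u\|_X<\infty\}$; (P1) $\|u\|_X=0$ iff $u=0$ a.e., $\|au\|_X=|a|\|u\|_X$ for $a\in\mathbb R$, and there is a constant $c\ge1$ (modulus of concavity) with $\|u+v\|_X\le c(\|u\|_X+\|v\|_X)$ for all $u,v$; (P2) if $|u|\le|v|$ a.e. then $\|u\|_X\le\|v\|_X$;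 (RF) if $u_n\ge0$ a.e. for all $n\in\mathbb N=\{1,2,\dots\}$, then $\|\sum_{n=1}^\infty u_n\|_X\le\sum_{n=1}^\infty c^n\|u_n\|_X$ (pointwise a.e. sum). The quasi-norm is assumed continuous: $\|u_n-u\|_X\to0$ implies $\|u_n\|_X\to\|u\|_X$. Elements of $X$ are functions defined everywhere on $\mathcal P$ (not equivalence classes); they are finite a.e. "$f_k\to f$ in $X$" means $f\in X$ and $\|f_k-f\|_X\to0$. A curve is a rectifiable non-constant continuous map from a compact interval into $\mathcal P$, always parameterized by arc length, $\gamma:[0,l_\gamma]\to\mathcal P$; $ds$ is arc length. The $X$-modulus of a family $\Gamma$ of curves is $\mathrm{Mod}_X(\Gamma)=\inf\|\rho\|_X$ over all Borel $\rho:\mathcal P\to[0,\infty]$ with $\int_\gamma\rho\,ds\ge1$ for all $\gamma\in\Gamma$. A property holds for $\mathrm{Mod}_X$-a.e. curve if the exceptional family has zero $X$-modulus. For a non-negative measurable $g$, $\int_\gamma g\,ds$ is well defined in $[0,\infty]$ for $\mathrm{Mod}_X$-a.e. $\gamma$. A Borel function $g:\mathcal P\to[0,\infty]$ is an upper gradient of $u:\mathcal P\to\mathbb R\cup\{\pm\infty\}$ if $|u(\gamma(0))-u(\gamma(l_\gamma))|\le\int_\gamma g\,ds$ for all curves $\gamma$, with the convention $|(\pm\infty)-(\pm\infty)|=\infty$. A non-negative (possibly $\infty$-valued) $\mu$-measurable $g$ is an $X$-weak upper gradient of $u$ if this inequality holds for $\mathrm{Mod}_X$-a.e. curve. The Dirichlet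 space $DX$ is the set of measurable (extended real-valued) functions having an upper gradient in $X$. The Newtonian space is $N^1X=X\cap DX$ (functions defined everywhere) with $\|u\|_{N^1X}=\|u\|_X+\inf_g\|g\|_X$, the infimum over all upper gradients $g$ of $u$ ($\|u\|_{N^1X}=\infty$ for measurable $u\notin N^1X$). The Sobolev $X$-capacity of $E\subset\mathcal P$ is $C_X(E)=\inf\{\|u\|_{N^1X}:u\ge1\text{ on }E\}$. A property holds quasi-everywhere (q.e.) if the set of exceptional points has $X$-capacity zero. *)

theory Defs
  imports "HOL-Analysis.Analysis"
begin

text \<open>Extended real-valued functions have type \<^typ>\<open>'a \<Rightarrow> ereal\<close>. The \<open>\<mu>\<close>-measurable ones are
  \<^term>\<open>borel_measurable M\<close>; the Borel ones are \<^term>\<open>borel_measurable borel\<close>. The \<open>\<sigma>\<close>-algebra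
  of \<open>M\<close> may be larger than the Borel \<open>\<sigma>\<close>-algebra, and \<open>M\<close> need not be complete.\<close>

locale borel_regular_metric_space = sigma_finite_measure M
  for M :: "'a::metric_space measure" +
  assumes space_eq: "space M = UNIV"
    and borel_sets: "sets borel \<subseteq> sets M"
    and borel_regular:
      "\<And>A. A \<in> sets M \<Longrightarrow> \<exists>D\<in>sets borel. A \<subseteq> D \<and> emeasure M D = emeasure M A"
    and ball_measure:
      "\<And>x r. 0 < r \<Longrightarrow> 0 < emeasure M (ball x r) \<and> emeasure M (ball x r) < \<infinity>"

text \<open>The values of the functional \<open>N\<close> outside \<^term>\<open>borel_measurable M\<close> are irrelevant: nothing is
  assumed about them, and they are never used.

  In \<open>triangle\<close>, the value of \<open>\<infinity> - \<infinity>\<close> plays no role: functions of finite quasi-norm are finite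
  a.e., and otherwise the right-hand side is \<open>\<infinity>\<close>. In \<open>Riesz_Fischer\<close>, the sequence
  \<open>u\<^sub>1, u\<^sub>2, \<dots>\<close> is indexed from 0, which explains the exponent \<open>Suc n\<close>.\<close>

locale quasi_Banach_function_lattice = borel_regular_metric_space M
  for M :: "'a::metric_space measure" +
  fixes N :: "('a \<Rightarrow> ereal) \<Rightarrow> ennreal" and c :: real
  assumes concavity_modulus: "1 \<le> c"
    and zero_iff: "\<And>u. u \<in> borel_measurable M \<Longrightarrow> N u = 0 \<longleftrightarrow> (AE x in M. u x = 0)"
    and scale: "\<And>u a. u \<in> borel_measurable M \<Longrightarrow> N (\<lambda>x. ereal a * u x) = ennreal \<bar>a\<bar> * N u"
    and triangle: "\<And>u v. u \<in> borel_measurable M \<Longrightarrow> v \<in> borel_measurable M \<Longrightarrow>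
      N (\<lambda>x. u x + v x) \<le> ennreal c * (N u + N v)"
    and lattice: "\<And>u v. u \<in> borel_measurable M \<Longrightarrow> v \<in> borel_measurable M \<Longrightarrow>
      (AE x in M. \<bar>u x\<bar> \<le> \<bar>v x\<bar>) \<Longrightarrow> N u \<le> N v"
    and Riesz_Fischer: "\<And>u v. (\<And>n::nat. u n \<in> borel_measurable M) \<Longrightarrow>
      (\<And>n. AE x in M. 0 \<le> u n x) \<Longrightarrow> v \<in> borel_measurable M \<Longrightarrow>
      (AE x in M. (\<lambda>n. u n x) sums v x) \<Longrightarrow> N v \<le> (\<Sum>n. ennreal c ^ Suc n * N (u n))"

definition continuous_quasi_norm :: "'a measure \<Rightarrow> (('a \<Rightarrow> ereal) \<Rightarrow> ennreal) \<Rightarrow> bool" where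
  "continuous_quasi_norm M N \<longleftrightarrow>
    (\<forall>us u. (\<forall>n::nat. us n \<in> borel_measurable M) \<and> u \<in> borel_measurable M \<and>
      (\<lambda>n. N (\<lambda>x. us n x - u x)) \<longlonglongrightarrow> 0 \<longrightarrow> (\<lambda>n. N (us n)) \<longlonglongrightarrow> N u)"

definition X_space :: "'a measure \<Rightarrow> (('a \<Rightarrow> ereal) \<Rightarrow> ennreal) \<Rightarrow> ('a \<Rightarrow> ereal) set" where
  "X_space M N = {u \<in> borel_measurable M. N u < \<infinity>}"

definition tendsto_in_X ::
    "'a measure \<Rightarrow> (('a \<Rightarrow> ereal) \<Rightarrow> ennreal) \<Rightarrow> (nat \<Rightarrow> 'a \<Rightarrow> ereal) \<Rightarrow> ('a \<Rightarrow> ereal) \<Rightarrow> bool" where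
  "tendsto_in_X M N fs f \<longleftrightarrow> f \<in> X_space M N \<and> (\<lambda>k. N (\<lambda>x. fs k x - f x)) \<longlonglongrightarrow> 0"

definition curve_length :: "(real \<Rightarrow> 'a::metric_space) \<Rightarrow> real \<Rightarrow> real \<Rightarrow> ennreal" where
  "curve_length \<gamma> a b = (SUP ts \<in> {ts. sorted ts \<and> set ts \<subseteq> {a..b}}.
     \<Sum>i<length ts - 1. ennreal (dist (\<gamma> (ts ! i)) (\<gamma> (ts ! Suc i))))"

text \<open>A pair \<open>(l, \<gamma>)\<close> represents the arc-length parametrized curve \<open>\<gamma> : [0,l] \<rightarrow> \<P>\<close>; values of \<open>\<gamma>\<close>
  outside \<open>[0,l]\<close> are irrelevant. Non-constancy forces \<open>l > 0\<close>, and the last conjunct with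
  \<open>t = l\<close> gives rectifiability.\<close>

type_synonym 'a curve = "real \<times> (real \<Rightarrow> 'a)"

definition curves :: "'a::metric_space curve set" where
  "curves = {(l, \<gamma>). continuous_on {0..l} \<gamma> \<and> \<not> \<gamma> constant_on {0..l} \<and>
     (\<forall>t\<in>{0..l}. curve_length \<gamma> 0 t = ennreal t)}"

text \<open>Only used for non-negative \<open>g\<close>, where \<^const>\<open>e2ennreal\<close> is the identification of the
  non-negative part of \<^typ>\<open>ereal\<close> with \<^typ>\<open>ennreal\<close>. For a non-measurable integrand the library's
  integral is a lower integral, so well-definedness is a separate predicate.\<close>

definition curve_integral :: "('a \<Rightarrow> ereal) \<Rightarrow> 'a curve \<Rightarrow> ennreal" where
  "curve_integral g = (\<lambda>(l, \<gamma>). \<integral>\<^sup>+t. e2ennreal (g (\<gamma> t)) \<partial>lebesgue_on {0..l})"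

definition curve_integral_defined :: "('a \<Rightarrow> ereal) \<Rightarrow> 'a curve \<Rightarrow> bool" where
  "curve_integral_defined g = (\<lambda>(l, \<gamma>). (\<lambda>t. g (\<gamma> t)) \<in> borel_measurable (lebesgue_on {0..l}))"

definition modulus :: "(('a::metric_space \<Rightarrow> ereal) \<Rightarrow> ennreal) \<Rightarrow> 'a curve set \<Rightarrow> ennreal" where
  "modulus N \<Gamma> = Inf {N \<rho> | \<rho>. \<rho> \<in> borel_measurable borel \<and> (\<forall>x. 0 \<le> \<rho> x) \<and>
     (\<forall>\<gamma>\<in>\<Gamma>. 1 \<le> curve_integral \<rho> \<gamma>)}"

definition almost_every_curve ::
    "(('a::metric_space \<Rightarrow> ereal) \<Rightarrow> ennreal) \<Rightarrow> ('a curve \<Rightarrow> bool) \<Rightarrow> bool" where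
  "almost_every_curve N P \<longleftrightarrow> modulus N {\<gamma> \<in> curves. \<not> P \<gamma>} = 0"

text \<open>On \<^typ>\<open>ereal\<close>, both \<open>\<infinity> - \<infinity>\<close> and \<open>(-\<infinity>) - (-\<infinity>)\<close> equal \<open>\<infinity>\<close>, so the library's subtraction
  realizes the convention \<open>\<bar>(\<plusminus>\<infinity>) - (\<plusminus>\<infinity>)\<bar> = \<infinity>\<close>.\<close>

lemma "\<bar>\<infinity> - \<infinity> :: ereal\<bar> = \<infinity>" "\<bar>(-\<infinity>) - (-\<infinity>) :: ereal\<bar> = \<infinity>"
  by simp_all

definition gradient_inequality :: "('a \<Rightarrow> ereal) \<Rightarrow> ('a \<Rightarrow> ereal) \<Rightarrow> 'a curve \<Rightarrow> bool" where
  "gradient_inequality g u =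
    (\<lambda>(l, \<gamma>). e2ennreal \<bar>u (\<gamma> 0) - u (\<gamma> l)\<bar> \<le> curve_integral g (l, \<gamma>))"

definition upper_gradient :: "('a::metric_space \<Rightarrow> ereal) \<Rightarrow> ('a \<Rightarrow> ereal) \<Rightarrow> bool" where
  "upper_gradient g u \<longleftrightarrow> g \<in> borel_measurable borel \<and> (\<forall>x. 0 \<le> g x) \<and>
    (\<forall>\<gamma>\<in>curves. gradient_inequality g u \<gamma>)"

definition weak_upper_gradient ::
    "'a::metric_space measure \<Rightarrow> (('a \<Rightarrow> ereal) \<Rightarrow> ennreal) \<Rightarrow> ('a \<Rightarrow> ereal) \<Rightarrow> ('a \<Rightarrow> ereal) \<Rightarrow> bool" where
  "weak_upper_gradient M N g u \<longleftrightarrow> g \<in> borel_measurable M \<and> (\<forall>x. 0 \<le> g x) \<and>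
    almost_every_curve N (\<lambda>\<gamma>. curve_integral_defined g \<gamma> \<and> gradient_inequality g u \<gamma>)"

definition Dirichlet_space ::
    "'a::metric_space measure \<Rightarrow> (('a \<Rightarrow> ereal) \<Rightarrow> ennreal) \<Rightarrow> ('a \<Rightarrow> ereal) set" where
  "Dirichlet_space M N = {u \<in> borel_measurable M. \<exists>g\<in>X_space M N. upper_gradient g u}"

definition Newtonian_space ::
    "'a::metric_space measure \<Rightarrow> (('a \<Rightarrow> ereal) \<Rightarrow> ennreal) \<Rightarrow> ('a \<Rightarrow> ereal) set" where
  "Newtonian_space M N = X_space M N \<inter> Dirichlet_space M N"

definition Newtonian_norm ::
    "'a::metric_space measure \<Rightarrow> (('a \<Rightarrow> ereal) \<Rightarrow> ennreal) \<Rightarrow> ('a \<Rightarrow> ereal) \<Rightarrow> ennreal" where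
  "Newtonian_norm M N u =
    (if u \<in> Newtonian_space M N then N u + Inf {N g | g. upper_gradient g u} else \<infinity>)"

definition Sobolev_capacity ::
    "'a::metric_space measure \<Rightarrow> (('a \<Rightarrow> ereal) \<Rightarrow> ennreal) \<Rightarrow> 'a set \<Rightarrow> ennreal" where
  "Sobolev_capacity M N E =
    Inf {Newtonian_norm M N u | u. u \<in> borel_measurable M \<and> (\<forall>x\<in>E. 1 \<le> u x)}"

definition quasi_everywhere ::
    "'a::metric_space measure \<Rightarrow> (('a \<Rightarrow> ereal) \<Rightarrow> ennreal) \<Rightarrow> ('a \<Rightarrow> bool) \<Rightarrow> bool" where
  "quasi_everywhere M N P \<longleftrightarrow> Sobolev_capacity M N {x. \<not> P x} = 0"

definition subsequence_tendsto_qe ::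
    "'a::metric_space measure \<Rightarrow> (('a \<Rightarrow> ereal) \<Rightarrow> ennreal) \<Rightarrow> (nat \<Rightarrow> 'a \<Rightarrow> ereal) \<Rightarrow> ('a \<Rightarrow> ereal) \<Rightarrow> bool" where
  "subsequence_tendsto_qe M N fs f \<longleftrightarrow>
    (\<exists>r. strict_mono (r :: nat \<Rightarrow> nat) \<and> quasi_everywhere M N (\<lambda>x. (\<lambda>j. fs (r j) x) \<longlonglongrightarrow> f x))"

end

theory Submission
  imports Defs
begin

text \<open>The gradients \<open>g\<^sub>k\<close> give no control on upper gradients of the differences \<open>f\<^sub>k - f\<^sub>m\<close>, so the
  sequence \<open>f\<^sub>k\<close> need not be Cauchy in the Newtonian norm. Convergence is instead obtained along
  single curves. After passing to a subsequence, the errors \<open>\<bar>f\<^sub>k - f\<bar>\<close> and \<open>\<bar>g\<^sub>k - g\<bar>\<close> have pointwise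
  sums of finite quasi-norm. Hence \<open>f\<^sub>k \<rightarrow> f\<close> almost everywhere, and for almost every curve \<open>\<gamma>\<close> the
  integrals of \<open>\<bar>g\<^sub>k - g\<bar>\<close> over \<open>\<gamma>\<close> tend to 0, the integral of \<open>g\<close> is finite, and \<open>f\<^sub>k (\<gamma> t) \<rightarrow> f (\<gamma> t)\<close>
  for almost every \<open>t\<close>.

  Fix such a \<open>\<gamma>\<close> for which, moreover, \<open>g\<^sub>k\<close> bounds the oscillation of \<open>f\<^sub>k\<close> on all subcurves. Then
  \<open>\<bar>f\<^sub>k (\<gamma> a) - f\<^sub>k (\<gamma> b)\<bar>\<close> is at most the integral of \<open>g\<close> over \<open>\<gamma>\<close> between \<open>a\<close> and \<open>b\<close> plus an error that
  tends to 0 uniformly in \<open>a\<close> and \<open>b\<close>. This is equicontinuity up to a vanishing error, so convergence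
  at almost every \<open>t\<close> improves to convergence to a finite limit at every \<open>t\<close>
  (\<open>convergence_along_curve\<close>), and the bound passes to the limit. Thus \<open>limsup f\<^sub>k\<close> is the required
  representative (\<open>limit_along_almost_every_curve\<close>): the set where \<open>f\<^sub>k\<close> fails to converge to it is null
  and almost every curve avoids it, which makes its capacity zero (\<open>capacity_zero_if_avoided\<close>).

  The last claim reduces to showing that \<open>f\<close> coincides with the representative on almost every curve.
  If \<open>f\<close> is a Newtonian function, the alternating sequence of the two functions converges almost
  everywhere on almost every curve, hence everywhere on it, which forces equality
  (\<open>Newtonian_AE_eq_imp_eq_along_curves\<close>). If a subsequence converges to \<open>f\<close> quasi-everywhere, the
  representative is constructed from that subsequence, and almost every curve avoids the exceptional set
  because its capacity is zero (\<open>avoided_if_capacity_zero\<close>).\<close>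

section \<open>Subcurves of arc-length parametrized curves\<close>

text \<open>The recursive form of the sum in \<^const>\<open>curve_length\<close>, which allows induction on partitions.\<close>

fun polygonal_length :: "(real \<Rightarrow> 'a::metric_space) \<Rightarrow> real list \<Rightarrow> ennreal" where
  "polygonal_length \<gamma> (s # t # ts) = ennreal (dist (\<gamma> s) (\<gamma> t)) + polygonal_length \<gamma> (t # ts)"
| "polygonal_length \<gamma> [] = 0"
| "polygonal_length \<gamma> [t] = 0"

lemma polygonal_length_eq_sum:
  "(\<Sum>i<length ts - 1. ennreal (dist (\<gamma> (ts ! i)) (\<gamma> (ts ! Suc i)))) = polygonal_length \<gamma> ts"
  by (induction \<gamma> ts rule: polygonal_length.induct) (auto simp: sum.lessThan_Suc_shift simp del: sum.lessThan_Suc)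

lemma curve_length_eq:
  "curve_length \<gamma> a b = (SUP ts\<in>{ts. sorted ts \<and> set ts \<subseteq> {a..b}}. polygonal_length \<gamma> ts)"
  by (simp only: curve_length_def polygonal_length_eq_sum)

lemma polygonal_length_append:
  "polygonal_length \<gamma> (xs @ b # ys) = polygonal_length \<gamma> (xs @ [b]) + polygonal_length \<gamma> (b # ys)"
proof (induction \<gamma> xs rule: polygonal_length.induct)
qed (auto simp: add.assoc)

lemma polygonal_length_insert:
  "polygonal_length \<gamma> (xs @ ys) \<le> polygonal_length \<gamma> (xs @ b # ys)"
proof (induction \<gamma> xs rule: polygonal_length.induct)
  case (2 \<gamma>)
  show ?case by (cases ys) auto
next
  case (3 \<gamma> t)
  show ?case
  proof (cases ys)
    case (Cons y zs)
    have "ennreal (dist (\<gamma> t) (\<gamma> y)) \<le> ennreal (dist (\<gamma> t) (\<gamma> b)) + ennreal (dist (\<gamma> b) (\<gamma> y))"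
      by (simp add: dist_triangle flip: ennreal_plus)
    then show ?thesis
      using Cons by (auto simp: add_right_mono simp flip: add.assoc)
  qed simp
qed (auto intro: add_left_mono)

lemma filter_append_sorted:
  "sorted ts \<Longrightarrow> filter (\<lambda>t. t \<le> b) ts @ filter (\<lambda>t. b < t) ts = (ts :: real list)"
proof (induction ts)
  case (Cons t ts)
  show ?case
  proof (cases "t \<le> b")
    case False
    then have "filter (\<lambda>t. t \<le> b) ts = []"
      using Cons.prems by (auto simp: filter_empty_conv)
    then show ?thesis using Cons False by auto
  qed (use Cons in auto)
qed simp

lemma curve_length_add:
  assumes "a \<le> b" "b \<le> c"
  shows "curve_length \<gamma> a c = curve_length \<gamma> a b + curve_length \<gamma> b c"
proof (rule antisym)
  have up: "polygonal_length \<gamma> ts \<le> curve_length \<gamma> x y" if "sorted ts" "set ts \<subseteq> {x..y}" for ts x y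
    unfolding curve_length_eq using that by (intro SUP_upper) auto
  \<comment> \<open>Cutting a partition at \<open>b\<close> can only lengthen the inscribed polygon.\<close>
  show "curve_length \<gamma> a c \<le> curve_length \<gamma> a b + curve_length \<gamma> b c"
    unfolding curve_length_eq[of \<gamma> a c]
  proof (intro SUP_least, clarify)
    fix ts assume ts: "sorted ts" "set ts \<subseteq> {a..c}"
    let ?xs = "filter (\<lambda>t. t \<le> b) ts" and ?ys = "filter (\<lambda>t. b < t) ts"
    have "polygonal_length \<gamma> ts = polygonal_length \<gamma> (?xs @ ?ys)"
      using filter_append_sorted[OF ts(1)] by simp
    also have "\<dots> \<le> polygonal_length \<gamma> (?xs @ [b]) + polygonal_length \<gamma> (b # ?ys)"
      using polygonal_length_insert polygonal_length_append by metis
    also have "\<dots> \<le> curve_length \<gamma> a b + curve_length \<gamma> b c"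
      using ts assms by (intro add_mono up) (auto simp: sorted_append sorted_wrt_filter less_imp_le)
    finally show "polygonal_length \<gamma> ts \<le> curve_length \<gamma> a b + curve_length \<gamma> b c" .
  qed
  \<comment> \<open>Joining partitions of both halves at \<open>b\<close> gives a partition of the whole interval.\<close>
  have "polygonal_length \<gamma> xs + polygonal_length \<gamma> ys \<le> curve_length \<gamma> a c"
    if "sorted xs" "set xs \<subseteq> {a..b}" "sorted ys" "set ys \<subseteq> {b..c}" for xs ys
  proof -
    have "polygonal_length \<gamma> xs + polygonal_length \<gamma> ys
        \<le> polygonal_length \<gamma> (xs @ [b]) + polygonal_length \<gamma> (b # ys)"
      using polygonal_length_insert[of \<gamma> xs "[]" b] polygonal_length_insert[of \<gamma> "[]" ys b]
      by (intro add_mono) auto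
    also have "\<dots> = polygonal_length \<gamma> (xs @ b # ys)"
      by (rule polygonal_length_append[symmetric])
    also have "\<dots> \<le> curve_length \<gamma> a c"
      using that assms by (intro up) (fastforce simp: sorted_append)+
    finally show ?thesis .
  qed
  then have "polygonal_length \<gamma> xs + curve_length \<gamma> b c \<le> curve_length \<gamma> a c"
    if "sorted xs" "set xs \<subseteq> {a..b}" for xs
    using that unfolding curve_length_eq[of \<gamma> b c]
    by (subst ennreal_SUP_add_right) (auto intro!: SUP_least exI[of _ "[]"])
  then show "curve_length \<gamma> a b + curve_length \<gamma> b c \<le> curve_length \<gamma> a c"
    unfolding curve_length_eq[of \<gamma> a b]
    by (subst ennreal_SUP_add_left[symmetric]) (auto intro!: SUP_least exI[of _ "[]"])
qed

lemma curve_length_translate: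
  "curve_length (\<lambda>t. \<gamma> (a + t)) 0 b = curve_length \<gamma> a (a + b)"
proof -
  have *: "polygonal_length (\<lambda>t. \<gamma> (a + t)) ts = polygonal_length \<gamma> (map ((+) a) ts)" for ts
    by (induction \<gamma> ts rule: polygonal_length.induct) auto
  have "map ((+) a) ` {ts. sorted ts \<and> set ts \<subseteq> {0..b}} = {ts. sorted ts \<and> set ts \<subseteq> {a..a+b}}"
  proof (intro equalityI subsetI)
    fix ts assume "ts \<in> {ts. sorted ts \<and> set ts \<subseteq> {a..a+b}}"
    then show "ts \<in> map ((+) a) ` {ts. sorted ts \<and> set ts \<subseteq> {0..b}}"
      by (intro image_eqI[of _ _ "map (\<lambda>t. t - a) ts"])
        (auto simp: sorted_map o_def intro: sorted_wrt_mono_rel[of _ "(\<le>)"])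
  qed (auto simp: sorted_map subset_iff intro: sorted_wrt_mono_rel[of _ "(\<le>)"])
  then show ?thesis
    unfolding curve_length_eq * by (metis (no_types, lifting) SUP_cong image_image)
qed

text \<open>Additivity of length gives \<open>a + L = a + t\<close> for the length \<open>L\<close> of the restriction to \<open>[a, a + t]\<close>, so
  restrictions are again parametrized by arc length.\<close>

lemma subcurve_in_curves:
  assumes "(l, \<gamma>) \<in> curves" "0 \<le> a" "a < b" "b \<le> l"
  shows "(b - a, \<lambda>t. \<gamma> (a + t)) \<in> curves"
proof -
  from assms have cont: "continuous_on {0..l} \<gamma>"
    and len: "\<And>t. t \<in> {0..l} \<Longrightarrow> curve_length \<gamma> 0 t = ennreal t"
    by (auto simp: curves_def)
  have len': "curve_length (\<lambda>t. \<gamma> (a + t)) 0 t = ennreal t" if "t \<in> {0..b-a}" for t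
  proof -
    have "ennreal a + curve_length \<gamma> a (a + t) = ennreal a + ennreal t"
      using curve_length_add[of 0 a "a + t" \<gamma>] len[of a] len[of "a + t"] assms that
      by (simp add: ennreal_plus)
    then show ?thesis
      unfolding curve_length_translate by (simp add: ennreal_add_left_cancel)
  qed
  have "\<not> (\<lambda>t. \<gamma> (a + t)) constant_on {0..b-a}"
  proof
    assume "(\<lambda>t. \<gamma> (a + t)) constant_on {0..b-a}"
    then have const: "\<gamma> (a + s) = \<gamma> (a + t)" if "s \<in> {0..b-a}" "t \<in> {0..b-a}" for s t
      using that by (auto simp: constant_on_def)
    have "polygonal_length (\<lambda>t. \<gamma> (a + t)) ts = 0" if "set ts \<subseteq> {0..b-a}" for ts
      using that by (induction "\<lambda>t. \<gamma> (a + t)" ts rule: polygonal_length.induct)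
        (auto simp: const dist_self intro!: const)
    then have "curve_length (\<lambda>t. \<gamma> (a + t)) 0 (b - a) = 0"
      unfolding curve_length_eq by (simp add: SUP_eq_iff bot_ennreal[symmetric] del: bot_ennreal)
    then show False using len'[of "b - a"] assms by auto
  qed
  moreover have "continuous_on {0..b-a} (\<lambda>t. \<gamma> (a + t))"
    using assms by (intro continuous_on_compose2[OF cont] continuous_intros) auto
  ultimately show ?thesis using len' by (auto simp: curves_def)
qed

lemma curves_pos: "(l, \<gamma>) \<in> curves \<Longrightarrow> 0 < l"
proof (rule ccontr)
  assume "(l, \<gamma>) \<in> curves" "\<not> 0 < l"
  moreover from this have "{0..l} \<subseteq> {0}" by auto
  ultimately show False
    by (auto simp: curves_def constant_on_def)
qed

lemma curves_continuous: "(l, \<gamma>) \<in> curves \<Longrightarrow> continuous_on {0..l} \<gamma>"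
  by (simp add: curves_def)

section \<open>Integration along curves\<close>

text \<open>The integral over the piece of a curve between the parameters \<open>a\<close> and \<open>b\<close>. The Borel--Lebesgue measure
  of the line replaces the restricted, completed measure in \<^const>\<open>curve_integral\<close>, so pieces of one curve are
  compared without changing the measure.\<close>

definition arc_integral :: "('a \<Rightarrow> ennreal) \<Rightarrow> (real \<Rightarrow> 'a) \<Rightarrow> real \<Rightarrow> real \<Rightarrow> ennreal" where
  "arc_integral G \<gamma> a b = (\<integral>\<^sup>+t\<in>{a..b}. G (\<gamma> t) \<partial>lborel)"

lemma curve_integral_eq_arc_integral:
  "curve_integral g (l, \<gamma>) = arc_integral (\<lambda>x. e2ennreal (g x)) \<gamma> 0 l"
  unfolding curve_integral_def arc_integral_def
  by (simp add: nn_integral_restrict_space nn_integral_completion)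

lemma measurable_along_curve:
  fixes G :: "'a::metric_space \<Rightarrow> ennreal" and \<gamma> :: "real \<Rightarrow> 'a"
  assumes "G \<in> borel_measurable borel" "continuous_on {0..l} \<gamma>" "0 \<le> a" "b \<le> l"
  shows "(\<lambda>t. G (\<gamma> t) * indicator {a..b} t) \<in> borel_measurable borel"
proof -
  have "continuous_on {a..b} \<gamma>"
    using assms by (intro continuous_on_subset[OF assms(2)]) auto
  then have "\<gamma> \<in> borel_measurable (restrict_space borel {a..b})"
    by (rule borel_measurable_continuous_on_restrict)
  then have "(\<lambda>t. G (\<gamma> t)) \<in> borel_measurable (restrict_space borel {a..b})"
    using assms(1) by (rule measurable_compose)
  then show ?thesis
    by (subst (asm) borel_measurable_restrict_space_iff_ennreal) auto
qed

lemma arc_integral_translate: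
  fixes G :: "'a::metric_space \<Rightarrow> ennreal" and \<gamma> :: "real \<Rightarrow> 'a"
  assumes "G \<in> borel_measurable borel" "continuous_on {0..l} \<gamma>" "0 \<le> a" "b \<le> l"
  shows "arc_integral G (\<lambda>t. \<gamma> (a + t)) 0 (b - a) = arc_integral G \<gamma> a b"
proof -
  have "indicator {0..b-a} t = (indicator {a..b} (a + t) :: ennreal)" for t
    by (auto simp: indicator_def)
  moreover have "(\<lambda>t. G (\<gamma> t) * indicator {a..b} t) \<in> borel_measurable borel"
    using assms by (rule measurable_along_curve)
  ultimately show ?thesis
    unfolding arc_integral_def
    using nn_integral_real_affine[of "\<lambda>t. G (\<gamma> t) * indicator {a..b} t" 1 a] by simp
qed

lemma arc_integral_mono_interval:
  "a \<le> a' \<Longrightarrow> b' \<le> b \<Longrightarrow> arc_integral G \<gamma> a' b' \<le> arc_integral G \<gamma> a b"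
  unfolding arc_integral_def by (intro nn_integral_mono) (auto simp: indicator_def)

lemma arc_integral_mono:
  "(\<And>x. G x \<le> H x) \<Longrightarrow> arc_integral G \<gamma> a b \<le> arc_integral H \<gamma> a b"
  unfolding arc_integral_def by (intro nn_integral_mono mult_right_mono) auto

lemma arc_integral_add:
  fixes G :: "'a::metric_space \<Rightarrow> ennreal" and \<gamma> :: "real \<Rightarrow> 'a"
  assumes "G \<in> borel_measurable borel" "H \<in> borel_measurable borel"
    "continuous_on {0..l} \<gamma>" "0 \<le> a" "b \<le> l"
  shows "arc_integral (\<lambda>x. G x + H x) \<gamma> a b = arc_integral G \<gamma> a b + arc_integral H \<gamma> a b"
  using measurable_along_curve[OF assms(1,3-)] measurable_along_curve[OF assms(2,3-)]
  unfolding arc_integral_def by (simp add: nn_integral_add distrib_right)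

lemma arc_integral_cmult:
  fixes G :: "'a::metric_space \<Rightarrow> ennreal" and \<gamma> :: "real \<Rightarrow> 'a"
  assumes "G \<in> borel_measurable borel" "continuous_on {0..l} \<gamma>" "0 \<le> a" "b \<le> l"
  shows "arc_integral (\<lambda>x. a' * G x) \<gamma> a b = a' * arc_integral G \<gamma> a b"
  using measurable_along_curve[OF assms]
  unfolding arc_integral_def by (simp add: nn_integral_cmult mult.assoc)

lemma arc_integral_suminf:
  fixes G :: "nat \<Rightarrow> 'a::metric_space \<Rightarrow> ennreal"
  assumes "\<And>n. G n \<in> borel_measurable borel" "continuous_on {0..l} \<gamma>" "0 \<le> a" "b \<le> l"
  shows "arc_integral (\<lambda>x. \<Sum>n. G n x) \<gamma> a b = (\<Sum>n. arc_integral (G n) \<gamma> a b)"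
  using measurable_along_curve[OF assms]
  unfolding arc_integral_def by (simp add: nn_integral_suminf flip: ennreal_suminf_multc)

text \<open>Lebesgue measurability is insensitive to null sets, by completeness.\<close>

lemma curve_integral_defined_if_AE_eq_Borel:
  fixes g :: "'a::metric_space \<Rightarrow> ereal" and \<gamma> :: "real \<Rightarrow> 'a"
  assumes "\<And>x. 0 \<le> g x" "G \<in> borel_measurable borel" "continuous_on {0..l} \<gamma>"
    and "AE t in lborel. t \<in> {0..l} \<longrightarrow> e2ennreal (g (\<gamma> t)) = G (\<gamma> t)"
  shows "curve_integral_defined g (l, \<gamma>)"
proof -
  let ?k = "\<lambda>t. enn2ereal (G (\<gamma> t) * indicator {0..l} t)"
  have "(\<lambda>t. G (\<gamma> t) * indicator {0..l} t) \<in> borel_measurable borel"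
    using assms(2,3) by (rule measurable_along_curve) auto
  then have k: "?k \<in> borel_measurable borel"
    by measurable
  show ?thesis
    unfolding curve_integral_defined_def split_conv
  proof (rule measurableI)
    fix A :: "ereal set" assume A: "A \<in> sets borel"
    have "?k -` A \<inter> {0..l} \<in> sets borel"
      using measurable_sets[OF k A] by auto
    then have "?k -` A \<inter> {0..l} \<in> sets lebesgue"
      by (simp add: sets_completionI_sets)
    moreover have "AE t in lebesgue. t \<in> ?k -` A \<inter> {0..l} \<longleftrightarrow> t \<in> (\<lambda>t. g (\<gamma> t)) -` A \<inter> {0..l}"
      using AE_completion[OF assms(4)]
    proof eventually_elim
      case (elim t)
      have "?k t = g (\<gamma> t)" if "t \<in> {0..l}"
        using elim that enn2ereal_e2ennreal[OF assms(1)[of "\<gamma> t"]] by simp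
      then show ?case by auto
    qed
    ultimately have "(\<lambda>t. g (\<gamma> t)) -` A \<inter> {0..l} \<in> sets lebesgue"
      by (elim completion.in_sets_AE[rotated, where A = "?k -` A \<inter> {0..l}"]) simp_all
    then show "(\<lambda>t. g (\<gamma> t)) -` A \<inter> space (lebesgue_on {0..l}) \<in> sets (lebesgue_on {0..l})"
      by (subst sets_restrict_space_iff) auto
  qed auto
qed

section \<open>Auxiliary facts on extended numbers\<close>

lemma rapid_subsequence:
  fixes a :: "nat \<Rightarrow> ennreal"
  assumes "a \<longlonglongrightarrow> 0" "\<And>n. 0 < \<delta> n"
  obtains r :: "nat \<Rightarrow> nat" where "strict_mono r" "\<And>n. a (r n) < \<delta> n"
proof -
  have "\<exists>K. \<forall>k\<ge>K. a k < \<delta> n" for n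
    using order_tendstoD(2)[OF assms(1,2)] by (auto simp: eventually_sequentially)
  then obtain K where K: "\<And>n k. K n \<le> k \<Longrightarrow> a k < \<delta> n" by metis
  \<comment> \<open>The partial sums dominate \<open>K\<close> and increase strictly thanks to \<open>Suc\<close>.\<close>
  define r where "r n = (\<Sum>i\<le>n. Suc (K i))" for n
  have "strict_mono r" by (intro strict_monoI_Suc) (simp add: r_def)
  moreover have "K n \<le> r n" for n
    by (cases n) (auto simp: r_def)
  ultimately show thesis using that K by blast
qed

lemma ennreal_eq_0_if_multiples_bounded:
  fixes a b :: ennreal
  assumes le: "\<And>n. of_nat n * a \<le> b" and "b < top"
  shows "a = 0"
proof (rule ccontr)
  assume "a \<noteq> 0"
  have "a < top"
    using le[of 1] \<open>b < top\<close> by auto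
  then have "b / a < top"
    using \<open>a \<noteq> 0\<close> \<open>b < top\<close> by (metis ennreal_divide_eq_top_iff less_top)
  then obtain n where "b / a < of_nat n"
    using ennreal_Ex_less_of_nat by blast
  then have "b < of_nat n * a"
    using \<open>a \<noteq> 0\<close> \<open>a < top\<close> by (simp add: divide_less_ennreal)
  then show False
    using le[of n] by auto
qed

lemma ennreal_suminf_one: "(\<Sum>n::nat. 1 :: ennreal) = top"
proof (rule ccontr)
  assume "(\<Sum>n::nat. 1 :: ennreal) \<noteq> top"
  then obtain n where "(\<Sum>n::nat. 1 :: ennreal) < of_nat n"
    using ennreal_Ex_less_of_nat less_top by blast
  then show False
    using sum_le_suminf[of "\<lambda>n. 1 :: ennreal" "{..<n}"] by simp
qed

lemma suminf_finite_imp_tendsto_0: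
  fixes a :: "nat \<Rightarrow> ennreal"
  assumes "(\<Sum>n. a n) < top"
  shows "a \<longlonglongrightarrow> 0"
proof -
  have eq: "ennreal (enn2real (a n)) = a n" for n
    using ennreal_suminf_lessD[OF assms] by simp
  then have "summable (\<lambda>n. enn2real (a n))"
    using assms by (intro summable_suminf_not_top) auto
  then have "(\<lambda>n. ennreal (enn2real (a n))) \<longlonglongrightarrow> ennreal 0"
    by (intro tendsto_ennrealI summable_LIMSEQ_zero)
  then show ?thesis by (simp add: eq)
qed

lemma ennreal_le_add_abs_diff:
  "a \<le> b + e2ennreal \<bar>enn2ereal a - enn2ereal b\<bar>"
proof (cases a; cases b)
  fix r s :: real assume "a = ennreal r" "0 \<le> r" "b = ennreal s" "0 \<le> s"
  then show ?thesis by (simp flip: ennreal_plus)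
qed auto

lemma ereal_abs_minus_swap: "\<bar>a - b\<bar> = \<bar>b - a :: ereal\<bar>"
  by (cases a; cases b) auto

lemma tendsto_if_abs_diff_tendsto_0:
  fixes y :: "nat \<Rightarrow> ereal"
  assumes "(\<lambda>k. e2ennreal \<bar>y k - a\<bar>) \<longlonglongrightarrow> 0" "\<bar>a\<bar> \<noteq> \<infinity>"
  shows "y \<longlonglongrightarrow> a"
proof -
  obtain r where r: "a = ereal r" using assms(2) by (cases a) auto
  have lim: "(\<lambda>k. \<bar>y k - a\<bar>) \<longlonglongrightarrow> 0"
    using tendsto_enn2ereal_iff[THEN iffD2, OF assms(1)]
    by (simp add: enn2ereal_e2ennreal zero_ennreal.rep_eq)
  show ?thesis
    unfolding r
  proof (rule order_tendstoI)
    fix z assume "z < ereal r"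
    then have "eventually (\<lambda>k. \<bar>y k - a\<bar> < ereal r - z) sequentially"
      by (intro order_tendstoD(2)[OF lim]) (cases z, auto)
    then show "eventually (\<lambda>k. z < y k) sequentially"
    proof eventually_elim
      case (elim k)
      then show ?case using \<open>z < ereal r\<close> by (cases z; cases "y k") (auto simp: r)
    qed
  next
    fix z assume "ereal r < z"
    then have "eventually (\<lambda>k. \<bar>y k - a\<bar> < z - ereal r) sequentially"
      by (intro order_tendstoD(2)[OF lim]) (cases z, auto)
    then show "eventually (\<lambda>k. y k < z) sequentially"
    proof eventually_elim
      case (elim k)
      then show ?case using \<open>ereal r < z\<close> by (cases z; cases "y k") (auto simp: r)
    qed
  qed
qed

text \<open>The Cauchy criterion: the approximating constants \<open>L\<close> may vary with \<open>\<eta>\<close>.\<close>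

lemma ereal_convergent_if_nearly_constant:
  fixes y :: "nat \<Rightarrow> ereal"
  assumes "\<And>\<eta>::real. 0 < \<eta> \<Longrightarrow> \<exists>L::real. eventually (\<lambda>k. \<bar>y k - ereal L\<bar> < ereal \<eta>) sequentially"
  shows "\<exists>L::real. y \<longlonglongrightarrow> ereal L"
proof -
  define x where "x k = real_of_ereal (y k)" for k
  have "eventually (\<lambda>k. y k = ereal (x k)) sequentially"
  proof -
    obtain L :: real where "eventually (\<lambda>k. \<bar>y k - ereal L\<bar> < ereal 1) sequentially"
      using assms[of 1] by auto
    then show ?thesis
    proof eventually_elim
      case (elim k)
      then show ?case by (cases "y k") (auto simp: x_def)
    qed
  qed
  note y_eq = this
  have "Cauchy x"
  proof (rule metric_CauchyI)
    fix e :: real assume "0 < e"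
    then obtain L :: real where "eventually (\<lambda>k. \<bar>y k - ereal L\<bar> < ereal (e / 2)) sequentially"
      using assms[of "e / 2"] by auto
    with y_eq have "eventually (\<lambda>k. \<bar>x k - L\<bar> < e / 2) sequentially"
      by eventually_elim simp
    then obtain K where K: "\<And>k. K \<le> k \<Longrightarrow> \<bar>x k - L\<bar> < e / 2"
      by (auto simp: eventually_sequentially)
    show "\<exists>K. \<forall>m\<ge>K. \<forall>n\<ge>K. dist (x m) (x n) < e"
    proof (intro exI allI impI)
      fix m n assume "K \<le> m" "K \<le> n"
      then show "dist (x m) (x n) < e"
        using K[of m] K[of n] unfolding dist_real_def by linarith
    qed
  qed
  then obtain L where "x \<longlonglongrightarrow> L"
    by (meson Cauchy_convergent convergentD)
  then have "(\<lambda>k. ereal (x k)) \<longlonglongrightarrow> ereal L" by simp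
  then have "y \<longlonglongrightarrow> ereal L"
    using tendsto_cong[OF y_eq] by blast
  then show ?thesis by blast
qed

section \<open>The quasi-norm of non-negative functions\<close>

context quasi_Banach_function_lattice
begin

lemma borel_measurable_imp_M:
  "f \<in> borel_measurable borel \<Longrightarrow> f \<in> borel_measurable M"
  using borel_sets by (auto simp: measurable_def space_eq)

text \<open>Non-negative functions are taken with values in \<^typ>\<open>ennreal\<close>, where infinite sums and integrals
  need no side conditions.\<close>

definition nrm :: "('a \<Rightarrow> ennreal) \<Rightarrow> ennreal" where
  "nrm h = N (\<lambda>x. enn2ereal (h x))"

lemma nrm_mono:
  assumes "h \<in> borel_measurable M" "k \<in> borel_measurable M" "AE x in M. h x \<le> k x"
  shows "nrm h \<le> nrm k"
  unfolding nrm_def using assms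
  by (intro lattice) (auto simp: less_eq_ennreal.rep_eq elim!: eventually_mono)

lemma N_eq_nrm:
  assumes "u \<in> borel_measurable M"
  shows "N u = nrm (\<lambda>x. e2ennreal \<bar>u x\<bar>)"
  unfolding nrm_def using assms
  by (intro antisym lattice) (auto simp: enn2ereal_e2ennreal)

lemma nrm_cong_AE:
  assumes "h \<in> borel_measurable M" "k \<in> borel_measurable M" "AE x in M. h x = k x"
  shows "nrm h = nrm k"
  using assms by (intro antisym nrm_mono) (auto elim!: eventually_mono)

lemma nrm_eq_0: "h \<in> borel_measurable M \<Longrightarrow> AE x in M. h x = 0 \<Longrightarrow> nrm h = 0"
  unfolding nrm_def by (subst zero_iff) (auto elim!: eventually_mono simp: zero_ennreal.rep_eq)

lemma nrm_cmult:
  assumes "h \<in> borel_measurable M" "0 \<le> a"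
  shows "nrm (\<lambda>x. ennreal a * h x) = ennreal a * nrm h"
  using scale[of "\<lambda>x. enn2ereal (h x)" a] assms
  by (simp add: nrm_def times_ennreal.rep_eq)

lemma nrm_rescaled_tendsto_0:
  assumes "\<rho> \<in> borel_measurable M" "nrm \<rho> < top"
  shows "(\<lambda>n. nrm (\<lambda>x. ennreal (inverse (Suc n)) * \<rho> x)) \<longlonglongrightarrow> 0"
proof -
  have "(\<lambda>n. ennreal (inverse (Suc n)) * nrm \<rho>) \<longlonglongrightarrow> ennreal 0 * nrm \<rho>"
    using assms(2)
    by (intro tendsto_mult_ennreal tendsto_ennrealI LIMSEQ_inverse_real_of_nat tendsto_const) auto
  then show ?thesis
    using nrm_cmult[OF assms(1)] by simp
qed

lemma nrm_add:
  assumes "h \<in> borel_measurable M" "k \<in> borel_measurable M"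
  shows "nrm (\<lambda>x. h x + k x) \<le> ennreal c * (nrm h + nrm k)"
  using triangle[of "\<lambda>x. enn2ereal (h x)" "\<lambda>x. enn2ereal (k x)"] assms
  by (simp add: nrm_def plus_ennreal.rep_eq)

lemma nrm_add_finite:
  assumes "h \<in> borel_measurable M" "k \<in> borel_measurable M" "nrm h < top" "nrm k < top"
  shows "nrm (\<lambda>x. h x + k x) < top"
  by (rule le_less_trans[OF nrm_add[OF assms(1,2)]]) (use assms in \<open>simp add: ennreal_mult_less_top\<close>)

lemma nrm_suminf:
  assumes "\<And>n. h n \<in> borel_measurable M"
  shows "nrm (\<lambda>x. \<Sum>n. h n x) \<le> (\<Sum>n. ennreal c ^ Suc n * nrm (h n))"
  unfolding nrm_def
  by (rule Riesz_Fischer) (use assms in \<open>auto simp: summable_sums\<close>)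

lemma nrm_finite_AE:
  assumes "h \<in> borel_measurable M" "nrm h < top"
  shows "AE x in M. h x < top"
proof -
  let ?k = "\<lambda>x. indicator {x. h x = top} x :: ennreal"
  have k: "?k \<in> borel_measurable M"
    using assms(1) by measurable
  \<comment> \<open>Every multiple of the indicator of \<open>{h = \<infinity>}\<close> lies below \<open>h\<close>.\<close>
  have "of_nat n * nrm ?k \<le> nrm h" for n
  proof -
    have "of_nat n * nrm ?k = nrm (\<lambda>x. ennreal (real n) * ?k x)"
      using nrm_cmult[OF k, of "real n"] by (simp add: ennreal_of_nat_eq_real_of_nat)
    also have "\<dots> \<le> nrm h"
      using assms(1) k by (intro nrm_mono) (auto simp: indicator_def)
    finally show ?thesis .
  qed
  then have "nrm ?k = 0"
    using assms(2) by (rule ennreal_eq_0_if_multiples_bounded)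
  then have "AE x in M. enn2ereal (?k x) = 0"
    unfolding nrm_def using k by (subst (asm) zero_iff) auto
  then show ?thesis
    by (auto elim!: eventually_mono simp: indicator_def less_top zero_ennreal.rep_eq[symmetric] enn2ereal_inject of_bool_def split: if_splits)
qed

lemma AE_X_finite:
  assumes "u \<in> X_space M N"
  shows "AE x in M. \<bar>u x\<bar> \<noteq> \<infinity>"
proof -
  have u: "u \<in> borel_measurable M" "nrm (\<lambda>x. e2ennreal \<bar>u x\<bar>) < top"
    using assms N_eq_nrm[of u] by (auto simp: X_space_def)
  have "AE x in M. e2ennreal \<bar>u x\<bar> < top"
    using u by (intro nrm_finite_AE) measurable
  then show ?thesis by eventually_elim auto
qed

text \<open>The Riesz--Fischer property costs a factor \<open>c\<^sup>n\<^sup>+\<^sup>1\<close> for the \<open>n\<close>-th summand, so the summands are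
  required to be smaller than \<open>(2c)\<^sup>-\<^sup>n\<^sup>-\<^sup>1\<close>, and the norm of the sum is at most 1.\<close>

lemma nrm_suminf_finite:
  assumes h: "\<And>n. h n \<in> borel_measurable M" "\<And>n. nrm (h n) < ennreal ((1 / (2 * c)) ^ Suc n)"
  shows "nrm (\<lambda>x. \<Sum>n. h n x) < top"
proof -
  have "ennreal c ^ Suc n * nrm (h n) \<le> (1 / 2) ^ Suc n" for n
  proof -
    have "ennreal c ^ Suc n * nrm (h n) \<le> ennreal c ^ Suc n * ennreal ((1 / (2 * c)) ^ Suc n)"
      using h(2)[of n] by (intro mult_left_mono) (auto intro: less_imp_le)
    also have "\<dots> = (ennreal c * ennreal (1 / (2 * c))) ^ Suc n"
      using concavity_modulus by (simp only: power_mult_distrib) (subst ennreal_power, auto)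
    also have "ennreal c * ennreal (1 / (2 * c)) = ennreal (1 / 2)"
      using concavity_modulus by (simp flip: ennreal_mult)
    also have "ennreal (1 / 2) = 1 / 2"
      using divide_ennreal[of 1 2] by simp
    finally show ?thesis .
  qed
  then have "(\<Sum>n. ennreal c ^ Suc n * nrm (h n)) \<le> (\<Sum>n. (1 / 2 :: ennreal) ^ Suc n)"
    by (intro suminf_le) auto
  also have "\<dots> = ennreal 1"
  proof -
    have "(1 / 2 :: ennreal) ^ Suc n = ennreal ((1 / 2) ^ Suc n)" for n
      using divide_ennreal[of 1 2] by (subst ennreal_power[symmetric]) auto
    then show ?thesis
      by (subst suminf_ennreal_eq[OF _ power_half_series, symmetric]) auto
  qed
  finally have "nrm (\<lambda>x. \<Sum>n. h n x) \<le> ennreal 1"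
    using nrm_suminf[of h, OF h(1)] by (rule order_trans[rotated])
  then show ?thesis
    by (rule le_less_trans) simp
qed

lemma geometric_bound_pos: "0 < ennreal ((1 / (2 * c)) ^ Suc n)"
  using concavity_modulus by simp

text \<open>Convergence in quasi-norm is exploited through this: the subsequence tends to 0 both
  pointwise almost everywhere and in the mean along almost every curve, because its sum is finite
  there.\<close>

lemma summable_subsequence:
  assumes "\<And>k. h k \<in> borel_measurable M" "(\<lambda>k. nrm (h k)) \<longlonglongrightarrow> 0"
  obtains r :: "nat \<Rightarrow> nat" where "strict_mono r" "nrm (\<lambda>x. \<Sum>j. h (r j) x) < top"
proof -
  obtain r where "strict_mono r" "\<And>n. nrm (h (r n)) < ennreal ((1 / (2 * c)) ^ Suc n)"
    using rapid_subsequence[of "\<lambda>k. nrm (h k)" "\<lambda>n. ennreal ((1 / (2 * c)) ^ Suc n)",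
        OF assms(2) geometric_bound_pos] by blast
  then show thesis
    using that[of r] nrm_suminf_finite[of "\<lambda>j. h (r j)"] assms(1) by auto
qed

section \<open>Exceptional families of curves\<close>

text \<open>Fuglede's description of null families: a family has modulus zero iff a single function of finite
  norm has infinite integral over each of its curves. This turns statements about the modulus into
  statements about one function.\<close>

lemma almost_every_curve_iff:
  "almost_every_curve N P \<longleftrightarrow> (\<exists>\<rho>\<in>borel_measurable borel. nrm \<rho> < top \<and>
     (\<forall>l \<gamma>. (l, \<gamma>) \<in> curves \<longrightarrow> P (l, \<gamma>) \<or> arc_integral \<rho> \<gamma> 0 l = top))" (is "?L \<longleftrightarrow> ?R")
proof
  assume L: ?L
  have "\<exists>\<rho>\<in>borel_measurable borel. nrm \<rho> < ennreal ((1 / (2 * c)) ^ Suc n) \<and>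
    (\<forall>l \<gamma>. (l, \<gamma>) \<in> curves \<longrightarrow> P (l, \<gamma>) \<or> 1 \<le> arc_integral \<rho> \<gamma> 0 l)" for n
  proof -
    have "modulus N {\<gamma> \<in> curves. \<not> P \<gamma>} < ennreal ((1 / (2 * c)) ^ Suc n)"
      using L geometric_bound_pos unfolding almost_every_curve_def by simp
    then obtain \<rho> where \<rho>: "\<rho> \<in> borel_measurable borel" "\<forall>x. 0 \<le> \<rho> x"
      "\<forall>\<gamma>\<in>{\<gamma> \<in> curves. \<not> P \<gamma>}. 1 \<le> curve_integral \<rho> \<gamma>" "N \<rho> < ennreal ((1 / (2 * c)) ^ Suc n)"
      unfolding modulus_def Inf_less_iff by auto
    then show ?thesis
      by (intro bexI[of _ "\<lambda>x. e2ennreal (\<rho> x)"])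
        (auto simp: nrm_def enn2ereal_e2ennreal simp flip: curve_integral_eq_arc_integral)
  qed
  then obtain \<rho> where \<rho>: "\<And>n. \<rho> n \<in> borel_measurable borel"
    "\<And>n. nrm (\<rho> n) < ennreal ((1 / (2 * c)) ^ Suc n)"
    "\<And>n l \<gamma>. (l, \<gamma>) \<in> curves \<Longrightarrow> P (l, \<gamma>) \<or> 1 \<le> arc_integral (\<rho> n) \<gamma> 0 l"
    by metis
  \<comment> \<open>The sum has finite norm, and its integral is at least \<open>1 + 1 + \<dots>\<close>.\<close>
  show ?R
  proof (intro bexI conjI allI impI)
    show "nrm (\<lambda>x. \<Sum>n. \<rho> n x) < top"
      using \<rho> by (intro nrm_suminf_finite borel_measurable_imp_M)
    fix l and \<gamma> :: "real \<Rightarrow> 'a" assume \<gamma>: "(l, \<gamma>) \<in> curves"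
    have "arc_integral (\<lambda>x. \<Sum>n. \<rho> n x) \<gamma> 0 l = top" if "\<not> P (l, \<gamma>)"
    proof -
      have "(\<Sum>n::nat. 1::ennreal) \<le> (\<Sum>n. arc_integral (\<rho> n) \<gamma> 0 l)"
        using \<rho>(3)[OF \<gamma>] that by (intro suminf_le) auto
      then have "(\<Sum>n. arc_integral (\<rho> n) \<gamma> 0 l) = top"
        by (simp add: ennreal_suminf_one top_unique)
      then show ?thesis
        using arc_integral_suminf[of \<rho>, OF \<rho>(1) curves_continuous[OF \<gamma>], of 0 l] by simp
    qed
    then show "P (l, \<gamma>) \<or> arc_integral (\<lambda>x. \<Sum>n. \<rho> n x) \<gamma> 0 l = top" by blast
  qed (use \<rho> in simp)
next
  assume ?R
  then obtain \<rho> where \<rho>: "\<rho> \<in> borel_measurable borel" "nrm \<rho> < top"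
    "\<And>l \<gamma>. (l, \<gamma>) \<in> curves \<Longrightarrow> P (l, \<gamma>) \<or> arc_integral \<rho> \<gamma> 0 l = top" by blast
  \<comment> \<open>Small multiples of \<open>\<rho>\<close> stay admissible because the integrals are infinite.\<close>
  have "modulus N {\<gamma> \<in> curves. \<not> P \<gamma>} \<le> ennreal (inverse (Suc n)) * nrm \<rho>" for n
  proof -
    let ?\<rho> = "\<lambda>x. ennreal (inverse (Suc n)) * \<rho> x"
    have "1 \<le> arc_integral ?\<rho> \<gamma> 0 l" if "(l, \<gamma>) \<in> curves" "\<not> P (l, \<gamma>)" for l \<gamma>
    proof -
      have "arc_integral \<rho> \<gamma> 0 l = top"
        using \<rho>(3)[OF that(1)] that(2) by blast
      then show ?thesis
        by (subst arc_integral_cmult[OF \<rho>(1) curves_continuous[OF that(1)]])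
          (auto simp: ennreal_mult_top)
    qed
    then have "modulus N {\<gamma> \<in> curves. \<not> P \<gamma>} \<le> nrm ?\<rho>"
      using \<rho>(1) unfolding modulus_def nrm_def
      by (intro Inf_lower CollectI exI[of _ "\<lambda>x. enn2ereal (?\<rho> x)"])
        (auto simp: curve_integral_eq_arc_integral)
    then show ?thesis
      using nrm_cmult[OF borel_measurable_imp_M[OF \<rho>(1)], of "inverse (Suc n)"] by simp
  qed
  moreover have "(\<lambda>n. ennreal (inverse (Suc n)) * nrm \<rho>) \<longlonglongrightarrow> 0"
    using nrm_rescaled_tendsto_0[OF borel_measurable_imp_M[OF \<rho>(1)] \<rho>(2)]
      nrm_cmult[OF borel_measurable_imp_M[OF \<rho>(1)]] by simp
  ultimately have "modulus N {\<gamma> \<in> curves. \<not> P \<gamma>} \<le> 0"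
    by (intro LIMSEQ_le_const) auto
  then show ?L
    unfolding almost_every_curve_def by simp
qed

lemma almost_every_curveI:
  fixes P :: "'a curve \<Rightarrow> bool"
  assumes "\<rho> \<in> borel_measurable borel" "nrm \<rho> < top"
    "\<And>l \<gamma>. (l, \<gamma>) \<in> curves \<Longrightarrow> arc_integral \<rho> \<gamma> 0 l < top \<Longrightarrow> P (l, \<gamma>)"
  shows "almost_every_curve N P"
  unfolding almost_every_curve_iff using assms less_top by blast

lemma almost_every_curveE:
  fixes P :: "'a curve \<Rightarrow> bool"
  assumes "almost_every_curve N P"
  obtains \<rho> where "\<rho> \<in> borel_measurable borel" "nrm \<rho> < top"
    "\<And>l \<gamma>. (l, \<gamma>) \<in> curves \<Longrightarrow> arc_integral \<rho> \<gamma> 0 l < top \<Longrightarrow> P (l, \<gamma>)"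
  using assms unfolding almost_every_curve_iff by (metis less_irrefl)

lemma almost_every_curve_mono:
  assumes "almost_every_curve N P" "\<And>l \<gamma>. (l, \<gamma>) \<in> curves \<Longrightarrow> P (l, \<gamma>) \<Longrightarrow> Q (l, \<gamma>)"
  shows "almost_every_curve N Q"
  using assms(1) by (elim almost_every_curveE) (auto intro: almost_every_curveI assms(2))

lemma almost_every_curve_all:
  fixes P :: "nat \<Rightarrow> 'a curve \<Rightarrow> bool"
  assumes "\<And>n. almost_every_curve N (P n)"
  shows "almost_every_curve N (\<lambda>\<gamma>. \<forall>n. P n \<gamma>)"
proof -
  \<comment> \<open>Rescaling a witness keeps infinite integrals infinite, so its norm can be made as small as wanted.\<close>
  have "\<exists>\<rho>\<in>borel_measurable borel. nrm \<rho> < ennreal ((1 / (2 * c)) ^ Suc n) \<and>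
     (\<forall>l \<gamma>. (l, \<gamma>) \<in> curves \<longrightarrow> arc_integral \<rho> \<gamma> 0 l < top \<longrightarrow> P n (l, \<gamma>))" for n
  proof -
    obtain \<rho> where \<rho>: "\<rho> \<in> borel_measurable borel" "nrm \<rho> < top"
      "\<And>l \<gamma>. (l, \<gamma>) \<in> curves \<Longrightarrow> arc_integral \<rho> \<gamma> 0 l < top \<Longrightarrow> P n (l, \<gamma>)"
      using almost_every_curveE[OF assms] by blast
    have "eventually (\<lambda>m. nrm (\<lambda>x. ennreal (inverse (Suc m)) * \<rho> x) < ennreal ((1 / (2 * c)) ^ Suc n)) sequentially"
      using nrm_rescaled_tendsto_0[OF borel_measurable_imp_M] \<rho> geometric_bound_pos by (intro order_tendstoD) auto
    then obtain m where m: "nrm (\<lambda>x. ennreal (inverse (Suc m)) * \<rho> x) < ennreal ((1 / (2 * c)) ^ Suc n)"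
      by (auto simp: eventually_sequentially)
    show ?thesis
    proof (intro bexI conjI allI impI)
      show "nrm (\<lambda>x. ennreal (inverse (Suc m)) * \<rho> x) < ennreal ((1 / (2 * c)) ^ Suc n)" by (rule m)
      show "(\<lambda>x. ennreal (inverse (Suc m)) * \<rho> x) \<in> borel_measurable borel"
        using \<rho>(1) by measurable
      fix l and \<gamma> :: "real \<Rightarrow> 'a"
      assume \<gamma>: "(l, \<gamma>) \<in> curves" and "arc_integral (\<lambda>x. ennreal (inverse (Suc m)) * \<rho> x) \<gamma> 0 l < top"
      then have "ennreal (inverse (Suc m)) * arc_integral \<rho> \<gamma> 0 l < top"
        by (subst (asm) arc_integral_cmult[OF \<rho>(1) curves_continuous[OF \<gamma>]]) auto
      then have "arc_integral \<rho> \<gamma> 0 l < top"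
        by (auto simp: ennreal_mult_less_top)
      then show "P n (l, \<gamma>)" using \<rho>(3) \<gamma> by blast
    qed
  qed
  then obtain \<rho> where \<rho>: "\<And>n. \<rho> n \<in> borel_measurable borel"
     "\<And>n. nrm (\<rho> n) < ennreal ((1 / (2 * c)) ^ Suc n)"
     "\<And>n l \<gamma>. (l, \<gamma>) \<in> curves \<Longrightarrow> arc_integral (\<rho> n) \<gamma> 0 l < top \<Longrightarrow> P n (l, \<gamma>)"
    by metis
  show ?thesis
  proof (rule almost_every_curveI)
    show "nrm (\<lambda>x. \<Sum>n. \<rho> n x) < top"
      using \<rho> by (intro nrm_suminf_finite borel_measurable_imp_M)
    show "(\<lambda>x. \<Sum>n. \<rho> n x) \<in> borel_measurable borel" using \<rho>(1) by simp
    fix l and \<gamma> :: "real \<Rightarrow> 'a"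
    assume \<gamma>: "(l, \<gamma>) \<in> curves" and fin: "arc_integral (\<lambda>x. \<Sum>n. \<rho> n x) \<gamma> 0 l < top"
    have "arc_integral (\<rho> n) \<gamma> 0 l \<le> arc_integral (\<lambda>x. \<Sum>n. \<rho> n x) \<gamma> 0 l" for n
      using sum_le_suminf[of "\<lambda>n. \<rho> n x" "{n}" for x] by (intro arc_integral_mono) auto
    then show "\<forall>n. P n (l, \<gamma>)"
      using \<rho>(3)[OF \<gamma>] fin by (blast intro: le_less_trans)
  qed
qed

lemma almost_every_curve_conj:
  assumes "almost_every_curve N P" "almost_every_curve N Q"
  shows "almost_every_curve N (\<lambda>\<gamma>. P \<gamma> \<and> Q \<gamma>)"
proof -
  have "almost_every_curve N (\<lambda>\<gamma>. \<forall>n::nat. (if n = 0 then P else Q) \<gamma>)"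
    by (rule almost_every_curve_all) (use assms in simp)
  then show ?thesis
    by (rule almost_every_curve_mono) (metis zero_neq_one)
qed

lemma almost_every_curve_arc_integral_finite:
  assumes "G \<in> borel_measurable borel" "nrm G < top"
  shows "almost_every_curve N (\<lambda>(l, \<gamma>). arc_integral G \<gamma> 0 l < top)"
  using assms by (auto intro: almost_every_curveI)

text \<open>If \<open>\<rho>\<close> is integrable over a curve, it is integrable over every subcurve; so the same \<open>\<rho>\<close> witnesses
  the property for all subcurves at once, although there are uncountably many.\<close>

lemma almost_every_curve_subcurves:
  fixes P :: "'a curve \<Rightarrow> bool"
  assumes "almost_every_curve N P"
  shows "almost_every_curve N (\<lambda>(l, \<gamma>). \<forall>a b. 0 \<le> a \<longrightarrow> a < b \<longrightarrow> b \<le> l \<longrightarrow> P (b - a, \<lambda>t. \<gamma> (a + t)))"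
proof -
  obtain \<rho> where \<rho>: "\<rho> \<in> borel_measurable borel" "nrm \<rho> < top"
    "\<And>l \<gamma>. (l, \<gamma>) \<in> curves \<Longrightarrow> arc_integral \<rho> \<gamma> 0 l < top \<Longrightarrow> P (l, \<gamma>)"
    using almost_every_curveE[OF assms] by blast
  show ?thesis
  proof (rule almost_every_curveI[OF \<rho>(1,2)], clarify)
    fix l a b and \<gamma> :: "real \<Rightarrow> 'a"
    assume \<gamma>: "(l, \<gamma>) \<in> curves" "arc_integral \<rho> \<gamma> 0 l < top" and ab: "0 \<le> a" "a < b" "b \<le> l"
    have "arc_integral \<rho> (\<lambda>t. \<gamma> (a + t)) 0 (b - a) \<le> arc_integral \<rho> \<gamma> 0 l"
      using arc_integral_translate[OF \<rho>(1) curves_continuous[OF \<gamma>(1)] ab(1,3)] ab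
        arc_integral_mono_interval[of 0 a b l \<rho> \<gamma>] by simp
    then show "P (b - a, \<lambda>t. \<gamma> (a + t))"
      using \<rho>(3)[OF subcurve_in_curves[OF \<gamma>(1) ab]] \<gamma>(2) by (blast intro: le_less_trans)
  qed
qed

section \<open>Borel representatives along curves\<close>

lemma ex_Borel_superset_AE_eq:
  assumes "A \<in> sets M"
  obtains D where "D \<in> sets borel" "A \<subseteq> D" "D - A \<in> null_sets M"
proof -
  obtain F :: "nat \<Rightarrow> 'a set" where F: "range F \<subseteq> sets M" "(\<Union>i. F i) = UNIV" "\<And>i. emeasure M (F i) \<noteq> \<infinity>"
    using sigma_finite space_eq by metis
  have "\<exists>D\<in>sets borel. A \<inter> F i \<subseteq> D \<and> emeasure M D = emeasure M (A \<inter> F i)" for i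
    using F assms by (intro borel_regular) auto
  then obtain D where D: "\<And>i. D i \<in> sets borel" "\<And>i. A \<inter> F i \<subseteq> D i"
    "\<And>i. emeasure M (D i) = emeasure M (A \<inter> F i)" by metis
  have DM: "D i \<in> sets M" for i
    using D(1) borel_sets by auto
  \<comment> \<open>Finiteness on the piece \<open>F i\<close> turns equality of measures into a null difference.\<close>
  have null: "D i - A \<inter> F i \<in> null_sets M" for i
  proof (rule null_setsI)
    have "emeasure M (A \<inter> F i) \<le> emeasure M (F i)"
      using F assms by (intro emeasure_mono) auto
    then have fin: "emeasure M (A \<inter> F i) \<noteq> \<infinity>"
      using F(3)[of i] by (auto simp: top_unique)
    then show "emeasure M (D i - A \<inter> F i) = 0"
      using D DM F assms by (subst emeasure_Diff) (auto simp: D(3))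
    show "D i - A \<inter> F i \<in> sets M"
      using DM F assms by auto
  qed
  show thesis
  proof
    show "(\<Union>i. D i) \<in> sets borel" using D(1) by auto
    show sub: "A \<subseteq> (\<Union>i. D i)" 
    proof
      fix x assume "x \<in> A"
      moreover obtain i where "x \<in> F i" using F(2) by blast
      ultimately show "x \<in> (\<Union>i. D i)" using D(2)[of i] by blast
    qed
    show "(\<Union>i. D i) - A \<in> null_sets M"
    proof (rule null_sets_subset)
      show "(\<Union>i. D i - A \<inter> F i) \<in> null_sets M" using null by (intro null_sets_UN) auto
      show "(\<Union>i. D i) - A \<in> sets M" using DM assms by auto
    qed auto
  qed
qed

lemma ex_Borel_null_superset:
  assumes "A \<in> null_sets M"
  obtains D where "D \<in> sets borel" "A \<subseteq> D" "D \<in> null_sets M"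
proof -
  obtain D where D: "D \<in> sets borel" "A \<subseteq> D" "emeasure M D = emeasure M A"
    using borel_regular[of A] assms by auto
  then show thesis
    using that[of D] assms borel_sets by (auto simp: null_sets_def)
qed

text \<open>By Borel regularity and \<open>\<sigma>\<close>-finiteness, the \<open>\<sigma>\<close>-algebra of \<open>M\<close> lies in the completion of the
  Borel \<open>\<sigma>\<close>-algebra.\<close>

lemma ex_Borel_representative:
  fixes h :: "'a \<Rightarrow> ennreal"
  assumes "h \<in> borel_measurable M"
  obtains G where "G \<in> borel_measurable borel" "AE x in M. h x = G x"
proof -
  define B where "B = distr M borel (\<lambda>x. x)"
  have id[measurable]: "(\<lambda>x. x) \<in> measurable M borel"
    by (intro borel_measurable_imp_M) simp
  have em: "emeasure B A = emeasure M A" if "A \<in> sets borel" for A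
    using that by (simp add: B_def emeasure_distr space_eq)
  \<comment> \<open>A Borel hull of the complement of \<open>A\<close> yields a Borel subset of \<open>A\<close> with null difference.\<close>
  have "A \<in> sets (completion B)" if A: "A \<in> sets M" for A
  proof -
    have "- A \<in> sets M"
      using sets.compl_sets[OF A] by (simp add: space_eq Compl_eq_Diff_UNIV)
    then obtain D where D: "D \<in> sets borel" "- A \<subseteq> D" "D - (- A) \<in> null_sets M"
      by (rule ex_Borel_superset_AE_eq)
    obtain Z where Z: "Z \<in> sets borel" "D - (- A) \<subseteq> Z" "Z \<in> null_sets M"
      using ex_Borel_null_superset[OF D(3)] by blast
    show ?thesis
    proof (rule sets_completionI)
      show "A = (- D) \<union> (D - (- A))" using D(2) by auto
      show "Z \<in> null_sets B" using Z em by (auto simp: null_sets_def B_def)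
      show "- D \<in> sets B" using D(1) by (simp add: B_def)
    qed (rule Z(2))
  qed
  then have "h \<in> borel_measurable (completion B)"
    using assms by (auto simp: measurable_def space_eq B_def)
  then obtain G where G: "G \<in> borel_measurable B" "AE x in B. h x = G x"
    using completion_ex_borel_measurable by blast
  have "AE x in M. h x = G x"
    using G(2) unfolding B_def by (rule AE_distrD[OF id])
  moreover have "G \<in> borel_measurable borel"
    using G(1) by (simp add: B_def)
  ultimately show thesis
    using that by blast
qed

text \<open>The function that is \<open>\<infinity>\<close> on a Borel null set and 0 elsewhere has norm zero, so almost every curve
  spends no time in that set.\<close>

lemma almost_every_curve_AE:
  assumes "AE x in M. P x"
  shows "almost_every_curve N (\<lambda>(l, \<gamma>). AE t in lborel. t \<in> {0..l} \<longrightarrow> P (\<gamma> t))"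
proof -
  obtain Z where Z: "Z \<in> null_sets M" "\<And>x. \<not> P x \<Longrightarrow> x \<in> Z"
    using assms unfolding eventually_ae_filter space_eq by auto
  obtain D where D: "D \<in> sets borel" "Z \<subseteq> D" "D \<in> null_sets M"
    using ex_Borel_null_superset[OF Z(1)] by blast
  have meas: "(\<lambda>x. top * indicator D x :: ennreal) \<in> borel_measurable borel"
    using D(1) by measurable
  show ?thesis
  proof (rule almost_every_curveI)
    show "(\<lambda>x. top * indicator D x :: ennreal) \<in> borel_measurable borel" by (rule meas)
    have "AE x in M. (top * indicator D x :: ennreal) = 0"
      using AE_not_in[OF D(3)] by eventually_elim simp
    then show "nrm (\<lambda>x. top * indicator D x) < top"
      using meas by (subst nrm_eq_0) (auto intro: borel_measurable_imp_M)
    fix l and \<gamma> :: "real \<Rightarrow> 'a"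
    assume \<gamma>: "(l, \<gamma>) \<in> curves" and fin: "arc_integral (\<lambda>x. top * indicator D x) \<gamma> 0 l < top"
    have "(\<lambda>t. top * indicator D (\<gamma> t) * indicator {0..l} t :: ennreal) \<in> borel_measurable borel"
      using meas curves_continuous[OF \<gamma>] by (rule measurable_along_curve) auto
    then have "AE t in lborel. top * indicator D (\<gamma> t) * indicator {0..l} t \<noteq> (\<infinity> :: ennreal)"
      using fin unfolding arc_integral_def by (intro nn_integral_PInf_AE) auto
    then show "case (l, \<gamma>) of (l, \<gamma>) \<Rightarrow> AE t in lborel. t \<in> {0..l} \<longrightarrow> P (\<gamma> t)"
      unfolding split_conv
    proof eventually_elim
      case (elim t)
      then have "\<not> (\<gamma> t \<in> D \<and> t \<in> {0..l})" by (auto simp: indicator_def)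
      then show ?case using Z(2) D(2) by auto
    qed
  qed
qed

lemma curve_integral_Borel_representative:
  assumes g: "g \<in> borel_measurable M" "\<And>x. 0 \<le> g x"
  obtains G where "G \<in> borel_measurable borel" "AE x in M. e2ennreal (g x) = G x"
    "almost_every_curve N (\<lambda>(l, \<gamma>). curve_integral_defined g (l, \<gamma>) \<and>
       curve_integral g (l, \<gamma>) = arc_integral G \<gamma> 0 l)"
proof -
  have "(\<lambda>x. e2ennreal (g x)) \<in> borel_measurable M"
    using g(1) by measurable
  then obtain G where G: "G \<in> borel_measurable borel" "AE x in M. e2ennreal (g x) = G x"
    by (rule ex_Borel_representative)
  have "almost_every_curve N (\<lambda>(l, \<gamma>). AE t in lborel. t \<in> {0..l} \<longrightarrow> e2ennreal (g (\<gamma> t)) = G (\<gamma> t))"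
    using G(2) by (rule almost_every_curve_AE)
  then have "almost_every_curve N (\<lambda>(l, \<gamma>). curve_integral_defined g (l, \<gamma>) \<and>
       curve_integral g (l, \<gamma>) = arc_integral G \<gamma> 0 l)"
  proof (rule almost_every_curve_mono, unfold split_conv)
    fix l and \<gamma> :: "real \<Rightarrow> 'a"
    assume \<gamma>: "(l, \<gamma>) \<in> curves"
      and eq: "AE t in lborel. t \<in> {0..l} \<longrightarrow> e2ennreal (g (\<gamma> t)) = G (\<gamma> t)"
    have "curve_integral g (l, \<gamma>) = arc_integral G \<gamma> 0 l"
      unfolding curve_integral_eq_arc_integral arc_integral_def
      by (intro nn_integral_cong_AE eventually_mono[OF eq]) (auto simp: indicator_def)
    then show "curve_integral_defined g (l, \<gamma>) \<and> curve_integral g (l, \<gamma>) = arc_integral G \<gamma> 0 l"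
      using curve_integral_defined_if_AE_eq_Borel[OF g(2) G(1) curves_continuous[OF \<gamma>] eq] by blast
  qed
  then show thesis using that G by blast
qed

lemma nrm_Borel_representative:
  assumes "g \<in> borel_measurable M" "\<And>x. 0 \<le> g x" "G \<in> borel_measurable borel"
    "AE x in M. e2ennreal (g x) = G x"
  shows "nrm G = N g"
proof -
  have "nrm (\<lambda>x. e2ennreal \<bar>g x\<bar>) = nrm G"
    using assms(1,2,4) borel_measurable_imp_M[OF assms(3)] by (intro nrm_cong_AE) auto
  then show ?thesis
    using N_eq_nrm[OF assms(1)] by simp
qed

end

section \<open>Convergence along a single curve\<close>

lemma small_integral_near_point:
  fixes w :: "real \<Rightarrow> ennreal"
  assumes w: "(\<lambda>t. w t * indicator {0..l} t) \<in> borel_measurable borel"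
    and fin: "(\<integral>\<^sup>+t\<in>{0..l}. w t \<partial>lborel) < top" and "0 < \<eta>"
  obtains \<delta> where "0 < \<delta>"
    "\<And>a b. 0 \<le> a \<Longrightarrow> b \<le> l \<Longrightarrow> t - \<delta> \<le> a \<Longrightarrow> b \<le> t + \<delta> \<Longrightarrow> (\<integral>\<^sup>+s\<in>{a..b}. w s \<partial>lborel) < \<eta>"
proof -
  let ?J = "\<lambda>n. {t - inverse (Suc n)..t + inverse (Suc n)} :: real set"
  let ?v = "\<lambda>n s. w s * indicator {0..l} s * indicator (?J n) s"
  have "(\<lambda>n. \<integral>\<^sup>+s. ?v n s \<partial>lborel) \<longlonglongrightarrow> (\<integral>\<^sup>+s. 0 \<partial>(lborel :: real measure))"
  proof (rule nn_integral_dominated_convergence[where w = "\<lambda>s. w s * indicator {0..l} s"])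
    show "AE s in lborel. (\<lambda>n. ?v n s) \<longlonglongrightarrow> 0"
      using AE_lborel_singleton[of t]
    proof eventually_elim
      case (elim s)
      have "eventually (\<lambda>n. inverse (real (Suc n)) < \<bar>s - t\<bar>) sequentially"
        using elim by (intro order_tendstoD(2)[OF LIMSEQ_inverse_real_of_nat]) auto
      then have "eventually (\<lambda>n. ?v n s = 0) sequentially"
        by eventually_elim (auto simp: indicator_def)
      then show ?case by (rule tendsto_eventually)
    qed
    show "AE s in lborel. ?v n s \<le> w s * indicator {0..l} s" for n
      by (auto simp: indicator_def)
    show "?v n \<in> borel_measurable lborel" for n
      using w by measurable
  qed (use w fin in \<open>auto\<close>)
  then have "eventually (\<lambda>n. (\<integral>\<^sup>+s. ?v n s \<partial>lborel) < \<eta>) sequentially"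
    using \<open>0 < \<eta>\<close> by (intro order_tendstoD(2)) auto
  then obtain n where n: "(\<integral>\<^sup>+s. ?v n s \<partial>lborel) < \<eta>"
    by (auto simp: eventually_sequentially)
  show thesis
  proof (rule that[of "inverse (Suc n)"])
    fix a b :: real
    assume "0 \<le> a" "b \<le> l" "t - inverse (Suc n) \<le> a" "b \<le> t + inverse (Suc n)"
    then have "(\<integral>\<^sup>+s\<in>{a..b}. w s \<partial>lborel) \<le> (\<integral>\<^sup>+s. ?v n s \<partial>lborel)"
      by (intro nn_integral_mono) (auto simp: indicator_def)
    then show "(\<integral>\<^sup>+s\<in>{a..b}. w s \<partial>lborel) < \<eta>"
      using n by (rule le_less_trans)
  qed simp
qed

lemma AE_ex_in_interval:
  assumes "AE t in lborel. t \<in> {0..l} \<longrightarrow> P t" "0 \<le> p" "p < q" "q \<le> l"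
  shows "\<exists>s\<in>{p<..<q::real}. P s"
proof (rule ccontr)
  assume "\<not> ?thesis"
  then have "AE t in lborel. t \<notin> {p<..<q}"
    using assms(2-) by (intro eventually_mono[OF assms(1)]) auto
  then have "emeasure lborel {p<..<q} = 0"
    by (subst (asm) AE_iff_measurable[of "{p<..<q}"]) auto
  then show False using \<open>p < q\<close> by simp
qed

text \<open>The bound makes the sequence \<open>\<phi>\<close> equicontinuous up to the errors \<open>\<epsilon>\<close>: near \<open>t\<close> there is a point \<open>s\<close> where
  \<open>\<phi> k s\<close> converges, and \<open>\<phi> k t\<close> eventually stays close to \<open>\<phi> k s\<close>.\<close>

lemma convergence_along_interval:
  fixes \<phi> :: "nat \<Rightarrow> real \<Rightarrow> ereal" and w :: "real \<Rightarrow> ennreal"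
  assumes w: "(\<lambda>t. w t * indicator {0..l} t) \<in> borel_measurable borel"
    and fin: "(\<integral>\<^sup>+t\<in>{0..l}. w t \<partial>lborel) < top"
    and bound: "\<And>k a b. 0 \<le> a \<Longrightarrow> a < b \<Longrightarrow> b \<le> l \<Longrightarrow>
      e2ennreal \<bar>\<phi> k a - \<phi> k b\<bar> \<le> (\<integral>\<^sup>+t\<in>{a..b}. w t \<partial>lborel) + \<epsilon> k"
    and \<epsilon>: "\<epsilon> \<longlonglongrightarrow> 0"
    and conv: "AE t in lborel. t \<in> {0..l} \<longrightarrow> (\<lambda>k. \<phi> k t) \<longlonglongrightarrow> \<psi> t \<and> \<bar>\<psi> t\<bar> \<noteq> \<infinity>"
    and t: "0 < l" "t \<in> {0..l}"
  shows "\<exists>L::real. (\<lambda>k. \<phi> k t) \<longlonglongrightarrow> ereal L"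
proof (rule ereal_convergent_if_nearly_constant)
  fix \<eta> :: real assume "0 < \<eta>"
  obtain \<delta> where \<delta>: "0 < \<delta>"
    "\<And>a b. 0 \<le> a \<Longrightarrow> b \<le> l \<Longrightarrow> t - \<delta> \<le> a \<Longrightarrow> b \<le> t + \<delta> \<Longrightarrow>
      (\<integral>\<^sup>+s\<in>{a..b}. w s \<partial>lborel) < ennreal (\<eta> / 3)"
    using small_integral_near_point[OF w fin, of "ennreal (\<eta> / 3)" t] \<open>0 < \<eta>\<close> by auto
  \<comment> \<open>A convergence point \<open>s \<noteq> t\<close> near \<open>t\<close>; it lies to the left of \<open>t\<close> only if \<open>t = l\<close>.\<close>
  have *: "\<exists>s a b. (\<lambda>k. \<phi> k s) \<longlonglongrightarrow> \<psi> s \<and> \<bar>\<psi> s\<bar> \<noteq> \<infinity> \<and> 0 \<le> a \<and> a < b \<and> b \<le> l \<and>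
    t - \<delta> \<le> a \<and> b \<le> t + \<delta> \<and> (a = s \<and> b = t \<or> a = t \<and> b = s)"
  proof (cases "t < l")
    case True
    then obtain s where "s \<in> {t<..<min l (t + \<delta>)}" "(\<lambda>k. \<phi> k s) \<longlonglongrightarrow> \<psi> s \<and> \<bar>\<psi> s\<bar> \<noteq> \<infinity>"
      using AE_ex_in_interval[OF conv, of t "min l (t + \<delta>)"] \<delta>(1) t by auto
    then show ?thesis
      using t \<delta>(1) by (intro exI[of _ s] exI[of _ t]) auto
  next
    case False
    then obtain s where "s \<in> {max 0 (t - \<delta>)<..<t}" "(\<lambda>k. \<phi> k s) \<longlonglongrightarrow> \<psi> s \<and> \<bar>\<psi> s\<bar> \<noteq> \<infinity>"
      using AE_ex_in_interval[OF conv, of "max 0 (t - \<delta>)" t] \<delta>(1) t by auto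
    then show ?thesis
      using t \<delta>(1) by (intro exI[of _ s] exI[of _ t]) auto
  qed
  then obtain s a b where s: "(\<lambda>k. \<phi> k s) \<longlonglongrightarrow> \<psi> s" "\<bar>\<psi> s\<bar> \<noteq> \<infinity>"
    and ab: "0 \<le> a" "a < b" "b \<le> l" "t - \<delta> \<le> a" "b \<le> t + \<delta>" "a = s \<and> b = t \<or> a = t \<and> b = s"
    by (elim exE conjE)
  obtain L where L: "\<psi> s = ereal L" using s(2) by (cases "\<psi> s") auto
  have "eventually (\<lambda>k. \<epsilon> k < ennreal (\<eta> / 3)) sequentially"
    using \<epsilon> \<open>0 < \<eta>\<close> by (intro order_tendstoD(2)) auto
  moreover have "eventually (\<lambda>k. \<phi> k s \<in> {ereal (L - \<eta> / 3)<..<ereal (L + \<eta> / 3)}) sequentially"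
    using s(1) \<open>0 < \<eta>\<close> unfolding L by (intro topological_tendstoD) auto
  ultimately have "eventually (\<lambda>k. \<bar>\<phi> k t - ereal L\<bar> < ereal \<eta>) sequentially"
  proof eventually_elim
    case (elim k)
    have "e2ennreal \<bar>\<phi> k t - \<phi> k s\<bar> \<le> (\<integral>\<^sup>+t\<in>{a..b}. w t \<partial>lborel) + \<epsilon> k"
      using bound[OF ab(1-3), of k] ab(6) by (auto simp: ereal_abs_minus_swap)
    also have "\<dots> < ennreal (\<eta> / 3) + ennreal (\<eta> / 3)"
      using \<delta>(2)[OF ab(1,3-5)] elim(1) by (rule add_strict_mono)
    also have "\<dots> = e2ennreal (ereal (2 * \<eta> / 3))"
      using \<open>0 < \<eta>\<close> by (simp flip: ennreal_plus)
    finally have "e2ennreal \<bar>\<phi> k t - \<phi> k s\<bar> < e2ennreal (ereal (2 * \<eta> / 3))" .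
    then have "\<bar>\<phi> k t - \<phi> k s\<bar> < ereal (2 * \<eta> / 3)"
      using e2ennreal_mono[of "ereal (2 * \<eta> / 3)" "\<bar>\<phi> k t - \<phi> k s\<bar>"] by (metis not_less)
    then show ?case
      using elim(2) by (cases "\<phi> k t"; cases "\<phi> k s") (auto simp: abs_if split: if_splits)
  qed
  then show "\<exists>L::real. eventually (\<lambda>k. \<bar>\<phi> k t - ereal L\<bar> < ereal \<eta>) sequentially" by blast
qed

lemma tendsto_gradient_bound:
  fixes x y :: "nat \<Rightarrow> ereal"
  assumes "x \<longlonglongrightarrow> a" "y \<longlonglongrightarrow> b" "\<bar>a\<bar> \<noteq> \<infinity>" "\<bar>b\<bar> \<noteq> \<infinity>" "\<epsilon> \<longlonglongrightarrow> 0"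
    and "\<And>k. e2ennreal \<bar>x k - y k\<bar> \<le> I + \<epsilon> k"
  shows "e2ennreal \<bar>a - b\<bar> \<le> I"
proof (rule LIMSEQ_le)
  show "(\<lambda>k. e2ennreal \<bar>x k - y k\<bar>) \<longlonglongrightarrow> e2ennreal \<bar>a - b\<bar>"
    using assms by (intro tendsto_intros tendsto_e2ennrealI tendsto_abs_ereal tendsto_diff_ereal) auto
  show "(\<lambda>k. I + \<epsilon> k) \<longlonglongrightarrow> I"
    using tendsto_add[OF tendsto_const assms(5), of I] by simp
qed (use assms(6) in auto)

lemma convergence_along_curve:
  fixes \<phi> :: "nat \<Rightarrow> 'a::metric_space \<Rightarrow> ereal" and G :: "'a \<Rightarrow> ennreal"
  assumes \<gamma>: "(l, \<gamma>) \<in> curves"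
    and G: "G \<in> borel_measurable borel" "arc_integral G \<gamma> 0 l < top"
    and bound: "\<And>k a b. 0 \<le> a \<Longrightarrow> a < b \<Longrightarrow> b \<le> l \<Longrightarrow>
      e2ennreal \<bar>\<phi> k (\<gamma> a) - \<phi> k (\<gamma> b)\<bar> \<le> arc_integral G \<gamma> a b + \<epsilon> k"
    and \<epsilon>: "\<epsilon> \<longlonglongrightarrow> 0"
    and conv: "AE t in lborel. t \<in> {0..l} \<longrightarrow> (\<lambda>k. \<phi> k (\<gamma> t)) \<longlonglongrightarrow> \<psi> (\<gamma> t) \<and> \<bar>\<psi> (\<gamma> t)\<bar> \<noteq> \<infinity>"
  defines "u \<equiv> \<lambda>x. limsup (\<lambda>k. \<phi> k x)"
  shows "\<And>t. t \<in> {0..l} \<Longrightarrow> (\<lambda>k. \<phi> k (\<gamma> t)) \<longlonglongrightarrow> u (\<gamma> t) \<and> \<bar>u (\<gamma> t)\<bar> \<noteq> \<infinity>"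
    and "e2ennreal \<bar>u (\<gamma> 0) - u (\<gamma> l)\<bar> \<le> arc_integral G \<gamma> 0 l"
proof -
  have pos: "0 < l" using curves_pos[OF \<gamma>] .
  show conv_u: "(\<lambda>k. \<phi> k (\<gamma> t)) \<longlonglongrightarrow> u (\<gamma> t) \<and> \<bar>u (\<gamma> t)\<bar> \<noteq> \<infinity>" if t: "t \<in> {0..l}" for t
  proof -
    have "\<exists>L::real. (\<lambda>k. \<phi> k (\<gamma> t)) \<longlonglongrightarrow> ereal L"
    proof (rule convergence_along_interval[where w = "\<lambda>t. G (\<gamma> t)" and \<epsilon> = \<epsilon> and \<psi> = "\<lambda>t. \<psi> (\<gamma> t)"])
      show "(\<lambda>t. G (\<gamma> t) * indicator {0..l} t) \<in> borel_measurable borel"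
        using G(1) curves_continuous[OF \<gamma>] by (rule measurable_along_curve) auto
    qed (use bound G(2) \<epsilon> conv pos t in \<open>auto simp: arc_integral_def\<close>)
    then obtain L :: real where L: "(\<lambda>k. \<phi> k (\<gamma> t)) \<longlonglongrightarrow> ereal L" by blast
    then have "u (\<gamma> t) = ereal L"
      unfolding u_def by (intro lim_imp_Limsup) auto
    then show ?thesis using L by simp
  qed
  show "e2ennreal \<bar>u (\<gamma> 0) - u (\<gamma> l)\<bar> \<le> arc_integral G \<gamma> 0 l"
  proof (rule tendsto_gradient_bound)
    show "(\<lambda>k. \<phi> k (\<gamma> 0)) \<longlonglongrightarrow> u (\<gamma> 0)" "\<bar>u (\<gamma> 0)\<bar> \<noteq> \<infinity>"
      using conv_u[of 0] pos by auto
    show "(\<lambda>k. \<phi> k (\<gamma> l)) \<longlonglongrightarrow> u (\<gamma> l)" "\<bar>u (\<gamma> l)\<bar> \<noteq> \<infinity>"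
      using conv_u[of l] pos by auto
    show "e2ennreal \<bar>\<phi> k (\<gamma> 0) - \<phi> k (\<gamma> l)\<bar> \<le> arc_integral G \<gamma> 0 l + \<epsilon> k" for k
      using bound[of 0 l k] pos by simp
  qed (rule \<epsilon>)
qed

section \<open>Weak upper gradients\<close>

context quasi_Banach_function_lattice
begin

lemma upper_gradient_imp_weak:
  assumes "upper_gradient g u"
  shows "weak_upper_gradient M N g u"
proof -
  have g: "g \<in> borel_measurable borel" "\<And>x. 0 \<le> g x" "\<And>\<gamma>. \<gamma> \<in> curves \<Longrightarrow> gradient_inequality g u \<gamma>"
    using assms by (auto simp: upper_gradient_def)
  have "curve_integral_defined g (l, \<gamma>)" if "(l, \<gamma>) \<in> curves" for l \<gamma>
  proof (rule curve_integral_defined_if_AE_eq_Borel[OF g(2) _ curves_continuous[OF that]])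
    show "(\<lambda>x. e2ennreal (g x)) \<in> borel_measurable borel" using g(1) by measurable
  qed auto
  then have "almost_every_curve N (\<lambda>\<gamma>. curve_integral_defined g \<gamma> \<and> gradient_inequality g u \<gamma>)"
    using g(3) by (intro almost_every_curveI[of "\<lambda>_. 0"]) (auto simp: nrm_eq_0)
  then show ?thesis
    using g borel_measurable_imp_M[OF g(1)] by (auto simp: weak_upper_gradient_def)
qed

lemma weak_upper_gradient_Borel_representative:
  assumes "weak_upper_gradient M N g u"
  obtains G where "G \<in> borel_measurable borel" "AE x in M. e2ennreal (g x) = G x" "nrm G = N g"
    "almost_every_curve N (\<lambda>(l, \<gamma>). e2ennreal \<bar>u (\<gamma> 0) - u (\<gamma> l)\<bar> \<le> arc_integral G \<gamma> 0 l)"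
proof -
  have g: "g \<in> borel_measurable M" "\<And>x. 0 \<le> g x"
    and ae: "almost_every_curve N (\<lambda>\<gamma>. curve_integral_defined g \<gamma> \<and> gradient_inequality g u \<gamma>)"
    using assms by (auto simp: weak_upper_gradient_def)
  obtain G where G: "G \<in> borel_measurable borel" "AE x in M. e2ennreal (g x) = G x"
    "almost_every_curve N (\<lambda>(l, \<gamma>). curve_integral_defined g (l, \<gamma>) \<and>
       curve_integral g (l, \<gamma>) = arc_integral G \<gamma> 0 l)"
    using curve_integral_Borel_representative[OF g] by blast
  have "almost_every_curve N (\<lambda>(l, \<gamma>). e2ennreal \<bar>u (\<gamma> 0) - u (\<gamma> l)\<bar> \<le> arc_integral G \<gamma> 0 l)"
    using almost_every_curve_conj[OF ae G(3)]
    by (rule almost_every_curve_mono) (auto simp: gradient_inequality_def)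
  then show thesis
    using that G nrm_Borel_representative[OF g G(1,2)] by blast
qed

text \<open>Adding to a Borel representative of \<open>g\<close> a function whose integral over all exceptional curves is
  infinite makes the gradient inequality true for every curve.\<close>

lemma weak_upper_gradient_imp_upper_gradient:
  assumes "weak_upper_gradient M N g u" "N g < top"
  shows "\<exists>g'\<in>X_space M N. upper_gradient g' u"
proof -
  obtain G where G: "G \<in> borel_measurable borel" "nrm G = N g"
    "almost_every_curve N (\<lambda>(l, \<gamma>). e2ennreal \<bar>u (\<gamma> 0) - u (\<gamma> l)\<bar> \<le> arc_integral G \<gamma> 0 l)"
    using weak_upper_gradient_Borel_representative[OF assms(1)] by blast
  obtain \<rho> where \<rho>: "\<rho> \<in> borel_measurable borel" "nrm \<rho> < top"
    "\<And>l \<gamma>. (l, \<gamma>) \<in> curves \<Longrightarrow> arc_integral \<rho> \<gamma> 0 l < top \<Longrightarrow>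
      e2ennreal \<bar>u (\<gamma> 0) - u (\<gamma> l)\<bar> \<le> arc_integral G \<gamma> 0 l"
    using almost_every_curveE[OF G(3)] by auto
  let ?g = "\<lambda>x. enn2ereal (G x + \<rho> x)"
  have meas: "?g \<in> borel_measurable borel"
    using G(1) \<rho>(1) by measurable
  have "nrm (\<lambda>x. G x + \<rho> x) < top"
    using G \<rho> assms(2) by (intro nrm_add_finite borel_measurable_imp_M) auto
  then have "?g \<in> X_space M N"
    using meas by (auto simp: X_space_def nrm_def intro: borel_measurable_imp_M)
  moreover have "gradient_inequality ?g u (l, \<gamma>)" if \<gamma>: "(l, \<gamma>) \<in> curves" for l \<gamma>
  proof -
    have "curve_integral ?g (l, \<gamma>) = arc_integral G \<gamma> 0 l + arc_integral \<rho> \<gamma> 0 l"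
      using arc_integral_add[OF G(1) \<rho>(1) curves_continuous[OF \<gamma>], of 0 l]
      by (simp add: curve_integral_eq_arc_integral)
    then show ?thesis
      using \<rho>(3)[OF \<gamma>] by (cases "arc_integral \<rho> \<gamma> 0 l < top")
        (auto simp: gradient_inequality_def less_top[symmetric] add_increasing2)
  qed
  then have "upper_gradient ?g u"
    using meas by (auto simp: upper_gradient_def)
  ultimately show ?thesis by blast
qed

lemma gradient_bound_on_subcurves:
  assumes "G \<in> borel_measurable borel"
    "almost_every_curve N (\<lambda>(l, \<gamma>). e2ennreal \<bar>u (\<gamma> 0) - u (\<gamma> l)\<bar> \<le> arc_integral G \<gamma> 0 l)"
  shows "almost_every_curve N (\<lambda>(l, \<gamma>). \<forall>a b. 0 \<le> a \<longrightarrow> a < b \<longrightarrow> b \<le> l \<longrightarrow>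
    e2ennreal \<bar>u (\<gamma> a) - u (\<gamma> b)\<bar> \<le> arc_integral G \<gamma> a b)"
  using almost_every_curve_subcurves[OF assms(2)]
proof (rule almost_every_curve_mono, unfold split_conv, intro allI impI)
  fix l a b and \<gamma> :: "real \<Rightarrow> 'a"
  assume "(l, \<gamma>) \<in> curves" and ab: "0 \<le> a" "a < b" "b \<le> l"
    and *: "\<forall>a b. 0 \<le> a \<longrightarrow> a < b \<longrightarrow> b \<le> l \<longrightarrow>
      e2ennreal \<bar>u (\<gamma> (a + 0)) - u (\<gamma> (a + (b - a)))\<bar> \<le> arc_integral G (\<lambda>t. \<gamma> (a + t)) 0 (b - a)"
  then show "e2ennreal \<bar>u (\<gamma> a) - u (\<gamma> b)\<bar> \<le> arc_integral G \<gamma> a b"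
    using arc_integral_translate[OF assms(1) curves_continuous, of l \<gamma> a b] *[rule_format, OF ab] by simp
qed

lemma weak_upper_gradient_cong:
  assumes "weak_upper_gradient M N g f'"
    "almost_every_curve N (\<lambda>(l, \<gamma>). \<forall>t\<in>{0..l}. f (\<gamma> t) = f' (\<gamma> t))"
  shows "weak_upper_gradient M N g f"
proof -
  have "almost_every_curve N (\<lambda>\<gamma>. (curve_integral_defined g \<gamma> \<and> gradient_inequality g f' \<gamma>) \<and>
      (case \<gamma> of (l, \<gamma>) \<Rightarrow> \<forall>t\<in>{0..l}. f (\<gamma> t) = f' (\<gamma> t)))"
    using assms by (intro almost_every_curve_conj[of "\<lambda>\<gamma>. curve_integral_defined g \<gamma> \<and> gradient_inequality g f' \<gamma>"])
      (auto simp: weak_upper_gradient_def)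
  then have "almost_every_curve N (\<lambda>\<gamma>. curve_integral_defined g \<gamma> \<and> gradient_inequality g f \<gamma>)"
    by (rule almost_every_curve_mono) (use curves_pos in \<open>force simp: gradient_inequality_def\<close>)
  then show ?thesis
    using assms(1) by (auto simp: weak_upper_gradient_def)
qed

lemma Newtonian_if_weak_upper_gradient:
  assumes "f \<in> X_space M N" "weak_upper_gradient M N g f" "N g < top"
  shows "f \<in> Newtonian_space M N"
  using assms weak_upper_gradient_imp_upper_gradient[OF assms(2,3)]
  by (auto simp: Newtonian_space_def Dirichlet_space_def X_space_def)

section \<open>Limits along almost every curve\<close>

text \<open>The \<open>limsup\<close> represents the limit because it is defined everywhere and measurable even if \<open>M\<close> is
  not complete.\<close>

lemma limit_along_almost_every_curve:
  assumes fs: "\<And>k. fs k \<in> borel_measurable M"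
    and ug: "\<And>k. weak_upper_gradient M N (gs k) (fs k)"
    and f: "tendsto_in_X M N fs f" and g: "tendsto_in_X M N gs g" "\<And>x. 0 \<le> g x"
  obtains r :: "nat \<Rightarrow> nat" where "strict_mono r" "AE x in M. (\<lambda>j. fs (r j) x) \<longlonglongrightarrow> f x"
    "weak_upper_gradient M N g (\<lambda>x. limsup (\<lambda>j. fs (r j) x))"
    "almost_every_curve N (\<lambda>(l, \<gamma>). \<forall>t\<in>{0..l}. (\<lambda>j. fs (r j) (\<gamma> t)) \<longlonglongrightarrow> limsup (\<lambda>j. fs (r j) (\<gamma> t)))"
proof -
  have f_meas: "f \<in> borel_measurable M" and f_fin: "AE x in M. \<bar>f x\<bar> \<noteq> \<infinity>"
    and f_lim: "(\<lambda>k. N (\<lambda>x. fs k x - f x)) \<longlonglongrightarrow> 0"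
    using f AE_X_finite by (auto simp: tendsto_in_X_def X_space_def)
  have g_meas: "g \<in> borel_measurable M" and Ng: "N g < top"
    and g_lim: "(\<lambda>k. N (\<lambda>x. gs k x - g x)) \<longlonglongrightarrow> 0"
    using g by (auto simp: tendsto_in_X_def X_space_def)
  have gs: "gs k \<in> borel_measurable M" "0 \<le> gs k x" for k x
    using ug by (auto simp: weak_upper_gradient_def)
  obtain G' where G': "G' \<in> borel_measurable borel" "AE x in M. e2ennreal (g x) = G' x"
    "almost_every_curve N (\<lambda>(l, \<gamma>). curve_integral_defined g (l, \<gamma>) \<and>
       curve_integral g (l, \<gamma>) = arc_integral G' \<gamma> 0 l)"
    using curve_integral_Borel_representative[OF g_meas g(2)] by blast
  have nG': "nrm G' < top"
    using nrm_Borel_representative[OF g_meas g(2) G'(1,2)] Ng by simp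
  have "\<exists>G. G \<in> borel_measurable borel \<and> (AE x in M. e2ennreal (gs k x) = G x) \<and>
    almost_every_curve N (\<lambda>(l, \<gamma>). e2ennreal \<bar>fs k (\<gamma> 0) - fs k (\<gamma> l)\<bar> \<le> arc_integral G \<gamma> 0 l)" (is "\<exists>G. ?rep k G") for k
    by (rule weak_upper_gradient_Borel_representative[OF ug[of k]]) blast
  then have "\<exists>G. \<forall>k. ?rep k (G k)"
    by (intro choice allI)
  then obtain G where rep: "\<And>k. ?rep k (G k)" by blast
  note G = rep[THEN conjunct1] rep[THEN conjunct2, THEN conjunct1] rep[THEN conjunct2, THEN conjunct2]
  \<comment> \<open>\<open>G k \<le> G' + h k\<close>, so the integrals of \<open>h k\<close> bound the errors along a curve.\<close>
  define h where "h k x = e2ennreal \<bar>enn2ereal (G k x) - enn2ereal (G' x)\<bar>" for k x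
  define d where "d k x = e2ennreal \<bar>fs k x - f x\<bar>" for k x
  have h_meas: "h k \<in> borel_measurable borel" for k
    unfolding h_def using G(1)[of k] G'(1) by measurable
  have d_meas: "d k \<in> borel_measurable M" for k
    unfolding d_def using fs[of k] f_meas by measurable
  have nrm_h: "nrm (h k) = N (\<lambda>x. gs k x - g x)" for k
  proof -
    have "AE x in M. e2ennreal \<bar>gs k x - g x\<bar> = h k x"
      using G(2)[of k] G'(2)
    proof eventually_elim
      case (elim x)
      then show ?case
        using gs(2)[of k x] g(2)[of x] by (simp add: h_def enn2ereal_e2ennreal flip: elim)
    qed
    then have "nrm (\<lambda>x. e2ennreal \<bar>gs k x - g x\<bar>) = nrm (h k)"
      using gs(1)[of k] g_meas borel_measurable_imp_M[OF h_meas] by (intro nrm_cong_AE) auto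
    then show ?thesis
      using N_eq_nrm[of "\<lambda>x. gs k x - g x"] gs(1)[of k] g_meas by simp
  qed
  have nrm_d: "nrm (d k) = N (\<lambda>x. fs k x - f x)" for k
    using N_eq_nrm[of "\<lambda>x. fs k x - f x"] fs[of k] f_meas by (simp add: d_def[abs_def])
  have hd_meas: "(\<lambda>x. h k x + d k x) \<in> borel_measurable M" for k
    using borel_measurable_imp_M[OF h_meas[of k]] d_meas[of k] by measurable
  \<comment> \<open>One subsequence serves functions and gradients, since it is chosen for the sum of the errors.\<close>
  have "(\<lambda>k. nrm (\<lambda>x. h k x + d k x)) \<longlonglongrightarrow> 0"
  proof (rule tendsto_sandwich[OF _ _ tendsto_const])
    have "(\<lambda>k. ennreal c * (N (\<lambda>x. gs k x - g x) + N (\<lambda>x. fs k x - f x))) \<longlonglongrightarrow> ennreal c * (0 + 0)"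
      by (intro ennreal_tendsto_cmult tendsto_add g_lim f_lim) simp
    then show "(\<lambda>k. ennreal c * (N (\<lambda>x. gs k x - g x) + N (\<lambda>x. fs k x - f x))) \<longlonglongrightarrow> 0"
      by simp
    show "eventually (\<lambda>k. nrm (\<lambda>x. h k x + d k x)
        \<le> ennreal c * (N (\<lambda>x. gs k x - g x) + N (\<lambda>x. fs k x - f x))) sequentially"
      using nrm_add[OF borel_measurable_imp_M[OF h_meas] d_meas] nrm_h nrm_d by simp
  qed simp
  then obtain r :: "nat \<Rightarrow> nat" where r: "strict_mono r" and
    sum: "nrm (\<lambda>x. \<Sum>j. h (r j) x + d (r j) x) < top"
    using summable_subsequence[of "\<lambda>k x. h k x + d k x", OF hd_meas] by blast
  have sum_h: "nrm (\<lambda>x. \<Sum>j. h (r j) x) < top"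
    by (rule le_less_trans[OF nrm_mono sum])
      (use borel_measurable_imp_M[OF h_meas] hd_meas in \<open>auto intro!: suminf_le\<close>)
  have "AE x in M. (\<Sum>j. h (r j) x + d (r j) x) < top"
    using hd_meas sum by (intro nrm_finite_AE borel_measurable_suminf) auto
  with f_fin have conv: "AE x in M. (\<lambda>j. fs (r j) x) \<longlonglongrightarrow> f x \<and> \<bar>f x\<bar> \<noteq> \<infinity>"
  proof eventually_elim
    case (elim x)
    have "(\<Sum>j. d (r j) x) < top"
      by (rule le_less_trans[OF suminf_le elim(2)]) auto
    then have "(\<lambda>j. d (r j) x) \<longlonglongrightarrow> 0"
      by (rule suminf_finite_imp_tendsto_0)
    then show ?case
      using elim(1) unfolding d_def by (auto intro: tendsto_if_abs_diff_tendsto_0)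
  qed
  let ?u = "\<lambda>x. limsup (\<lambda>j. fs (r j) x)"
  let ?good = "\<lambda>(l, \<gamma>). (\<forall>t\<in>{0..l}. (\<lambda>j. fs (r j) (\<gamma> t)) \<longlonglongrightarrow> ?u (\<gamma> t)) \<and>
    curve_integral_defined g (l, \<gamma>) \<and> gradient_inequality g ?u (l, \<gamma>)"
  have sum_h_meas: "(\<lambda>x. \<Sum>j. h (r j) x) \<in> borel_measurable borel"
    using h_meas by simp
  \<comment> \<open>Everything that a curve needs for \<open>convergence_along_curve\<close> holds for almost every curve.\<close>
  have "almost_every_curve N (\<lambda>\<gamma>.
      ((case \<gamma> of (l, \<gamma>) \<Rightarrow> curve_integral_defined g (l, \<gamma>) \<and> curve_integral g (l, \<gamma>) = arc_integral G' \<gamma> 0 l) \<and>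
       (case \<gamma> of (l, \<gamma>) \<Rightarrow> arc_integral G' \<gamma> 0 l < top)) \<and>
      ((case \<gamma> of (l, \<gamma>) \<Rightarrow> arc_integral (\<lambda>x. \<Sum>j. h (r j) x) \<gamma> 0 l < top) \<and>
       (case \<gamma> of (l, \<gamma>) \<Rightarrow> AE t in lborel. t \<in> {0..l} \<longrightarrow>
         (\<lambda>j. fs (r j) (\<gamma> t)) \<longlonglongrightarrow> f (\<gamma> t) \<and> \<bar>f (\<gamma> t)\<bar> \<noteq> \<infinity>)) \<and>
      (\<forall>k. case \<gamma> of (l, \<gamma>) \<Rightarrow> \<forall>a b. 0 \<le> a \<longrightarrow> a < b \<longrightarrow> b \<le> l \<longrightarrow>
        e2ennreal \<bar>fs k (\<gamma> a) - fs k (\<gamma> b)\<bar> \<le> arc_integral (G k) \<gamma> a b))"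
    by (intro almost_every_curve_conj almost_every_curve_all G'(3)
        almost_every_curve_arc_integral_finite G'(1) nG' sum_h sum_h_meas almost_every_curve_AE[OF conv]
        gradient_bound_on_subcurves[OF G(1,3)])
  then have good: "almost_every_curve N ?good"
  proof (rule almost_every_curve_mono, unfold split_conv, elim conjE)
    fix l and \<gamma> :: "real \<Rightarrow> 'a"
    assume \<gamma>: "(l, \<gamma>) \<in> curves"
      and g_\<gamma>: "curve_integral_defined g (l, \<gamma>)" "curve_integral g (l, \<gamma>) = arc_integral G' \<gamma> 0 l"
      and G'_\<gamma>: "arc_integral G' \<gamma> 0 l < top"
      and h_\<gamma>: "arc_integral (\<lambda>x. \<Sum>j. h (r j) x) \<gamma> 0 l < top"
      and conv_\<gamma>: "AE t in lborel. t \<in> {0..l} \<longrightarrow> (\<lambda>j. fs (r j) (\<gamma> t)) \<longlonglongrightarrow> f (\<gamma> t) \<and> \<bar>f (\<gamma> t)\<bar> \<noteq> \<infinity>"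
      and G_\<gamma>: "\<forall>k a b. 0 \<le> a \<longrightarrow> a < b \<longrightarrow> b \<le> l \<longrightarrow>
        e2ennreal \<bar>fs k (\<gamma> a) - fs k (\<gamma> b)\<bar> \<le> arc_integral (G k) \<gamma> a b"
    note cont = curves_continuous[OF \<gamma>]
    let ?\<epsilon> = "\<lambda>j. arc_integral (h (r j)) \<gamma> 0 l"
    have "(\<Sum>j. ?\<epsilon> j) < top"
      using h_\<gamma> arc_integral_suminf[of "\<lambda>j. h (r j)", OF h_meas cont, of 0 l] by simp
    then have \<epsilon>: "?\<epsilon> \<longlonglongrightarrow> 0"
      by (rule suminf_finite_imp_tendsto_0)
    have bound: "e2ennreal \<bar>fs (r j) (\<gamma> a) - fs (r j) (\<gamma> b)\<bar> \<le> arc_integral G' \<gamma> a b + ?\<epsilon> j"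
      if ab: "0 \<le> a" "a < b" "b \<le> l" for j a b
    proof -
      have "e2ennreal \<bar>fs (r j) (\<gamma> a) - fs (r j) (\<gamma> b)\<bar> \<le> arc_integral (G (r j)) \<gamma> a b"
        using G_\<gamma> ab by blast
      also have "\<dots> \<le> arc_integral (\<lambda>x. G' x + h (r j) x) \<gamma> a b"
        unfolding h_def by (intro arc_integral_mono ennreal_le_add_abs_diff)
      also have "\<dots> = arc_integral G' \<gamma> a b + arc_integral (h (r j)) \<gamma> a b"
        using ab by (intro arc_integral_add[OF G'(1) h_meas cont]) auto
      also have "\<dots> \<le> arc_integral G' \<gamma> a b + ?\<epsilon> j"
        using ab by (intro add_left_mono arc_integral_mono_interval) auto
      finally show ?thesis .
    qed
    note limit = convergence_along_curve[where \<phi> = "\<lambda>j. fs (r j)", OF \<gamma> G'(1) G'_\<gamma> bound \<epsilon> conv_\<gamma>]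
    show "(\<forall>t\<in>{0..l}. (\<lambda>j. fs (r j) (\<gamma> t)) \<longlonglongrightarrow> ?u (\<gamma> t)) \<and>
      curve_integral_defined g (l, \<gamma>) \<and> gradient_inequality g ?u (l, \<gamma>)"
      using limit g_\<gamma> by (simp add: gradient_inequality_def)
  qed
  have "weak_upper_gradient M N g ?u"
    unfolding weak_upper_gradient_def
    using g_meas g(2) good by (auto elim: almost_every_curve_mono)
  moreover have "almost_every_curve N (\<lambda>(l, \<gamma>). \<forall>t\<in>{0..l}. (\<lambda>j. fs (r j) (\<gamma> t)) \<longlonglongrightarrow> ?u (\<gamma> t))"
    using good by (rule almost_every_curve_mono) auto
  moreover have "AE x in M. (\<lambda>j. fs (r j) x) \<longlonglongrightarrow> f x"
    using conv by eventually_elim auto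
  ultimately show thesis using that r by blast
qed

text \<open>Both functions are continuous along almost every curve and agree at almost every parameter. Applying
  \<open>convergence_along_curve\<close> to the sequence \<open>f, f', f, f', \<dots>\<close> replaces a separate treatment of continuity;
  the sum of the two gradients bounds both functions.\<close>

lemma Newtonian_AE_eq_imp_eq_along_curves:
  assumes "f \<in> Newtonian_space M N" "f' \<in> Newtonian_space M N" "AE x in M. f x = f' x"
  shows "almost_every_curve N (\<lambda>(l, \<gamma>). \<forall>t\<in>{0..l}. f (\<gamma> t) = f' (\<gamma> t))"
proof -
  have "\<exists>G. G \<in> borel_measurable borel \<and> nrm G < top \<and>
    almost_every_curve N (\<lambda>(l, \<gamma>). \<forall>a b. 0 \<le> a \<longrightarrow> a < b \<longrightarrow> b \<le> l \<longrightarrow>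
      e2ennreal \<bar>u (\<gamma> a) - u (\<gamma> b)\<bar> \<le> arc_integral G \<gamma> a b)"
    if u: "u \<in> Newtonian_space M N" for u
  proof -
    obtain g where g: "g \<in> X_space M N" "upper_gradient g u"
      using u by (auto simp: Newtonian_space_def Dirichlet_space_def)
    obtain G where "G \<in> borel_measurable borel" "nrm G = N g"
      "almost_every_curve N (\<lambda>(l, \<gamma>). e2ennreal \<bar>u (\<gamma> 0) - u (\<gamma> l)\<bar> \<le> arc_integral G \<gamma> 0 l)"
      using weak_upper_gradient_Borel_representative[OF upper_gradient_imp_weak[OF g(2)]] by blast
    then show ?thesis
      using g(1) gradient_bound_on_subcurves by (auto simp: X_space_def)
  qed
  from this[OF assms(1)] this[OF assms(2)] obtain G G' where
    G: "G \<in> borel_measurable borel" "nrm G < top"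
      "almost_every_curve N (\<lambda>(l, \<gamma>). \<forall>a b. 0 \<le> a \<longrightarrow> a < b \<longrightarrow> b \<le> l \<longrightarrow>
        e2ennreal \<bar>f (\<gamma> a) - f (\<gamma> b)\<bar> \<le> arc_integral G \<gamma> a b)"
    and G': "G' \<in> borel_measurable borel" "nrm G' < top"
      "almost_every_curve N (\<lambda>(l, \<gamma>). \<forall>a b. 0 \<le> a \<longrightarrow> a < b \<longrightarrow> b \<le> l \<longrightarrow>
        e2ennreal \<bar>f' (\<gamma> a) - f' (\<gamma> b)\<bar> \<le> arc_integral G' \<gamma> a b)"
    by blast
  have fin: "AE x in M. \<bar>f x\<bar> \<noteq> \<infinity>"
    using assms(1) by (intro AE_X_finite) (simp add: Newtonian_space_def)
  have eq: "AE x in M. f x = f' x \<and> \<bar>f x\<bar> \<noteq> \<infinity>"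
    using assms(3) fin by eventually_elim simp
  show ?thesis
    using almost_every_curve_conj[OF almost_every_curve_conj[OF G(3) G'(3)]
        almost_every_curve_conj[OF almost_every_curve_AE[OF eq]
          almost_every_curve_conj[OF almost_every_curve_arc_integral_finite[OF G(1,2)]
            almost_every_curve_arc_integral_finite[OF G'(1,2)]]]]
  proof (rule almost_every_curve_mono, unfold split_conv, elim conjE, intro ballI)
    fix l t and \<gamma> :: "real \<Rightarrow> 'a"
    assume \<gamma>: "(l, \<gamma>) \<in> curves"
      and f: "\<forall>a b. 0 \<le> a \<longrightarrow> a < b \<longrightarrow> b \<le> l \<longrightarrow> e2ennreal \<bar>f (\<gamma> a) - f (\<gamma> b)\<bar> \<le> arc_integral G \<gamma> a b"
      and f': "\<forall>a b. 0 \<le> a \<longrightarrow> a < b \<longrightarrow> b \<le> l \<longrightarrow> e2ennreal \<bar>f' (\<gamma> a) - f' (\<gamma> b)\<bar> \<le> arc_integral G' \<gamma> a b"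
      and eq: "AE t in lborel. t \<in> {0..l} \<longrightarrow> f (\<gamma> t) = f' (\<gamma> t) \<and> \<bar>f (\<gamma> t)\<bar> \<noteq> \<infinity>"
      and fin: "arc_integral G \<gamma> 0 l < top" "arc_integral G' \<gamma> 0 l < top"
      and t: "t \<in> {0..l}"
    note cont = curves_continuous[OF \<gamma>]
    \<comment> \<open>A pointwise convergent alternating sequence forces the two values to agree.\<close>
    define \<phi> where "\<phi> k = (if even k then f else f')" for k :: nat
    have add: "arc_integral (\<lambda>x. G x + G' x) \<gamma> a b = arc_integral G \<gamma> a b + arc_integral G' \<gamma> a b"
      if "0 \<le> a" "b \<le> l" for a b
      using that by (intro arc_integral_add[OF G(1) G'(1) cont])
    have "(\<lambda>k. \<phi> k (\<gamma> t)) \<longlonglongrightarrow> limsup (\<lambda>k. \<phi> k (\<gamma> t)) \<and> \<bar>limsup (\<lambda>k. \<phi> k (\<gamma> t))\<bar> \<noteq> \<infinity>"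
    proof (rule convergence_along_curve[OF \<gamma>, where \<epsilon> = "\<lambda>_. 0" and \<psi> = f])
      show "(\<lambda>x. G x + G' x) \<in> borel_measurable borel"
        using G(1) G'(1) by measurable
      show "arc_integral (\<lambda>x. G x + G' x) \<gamma> 0 l < top"
        using fin add[of 0 l] by simp
      show "e2ennreal \<bar>\<phi> k (\<gamma> a) - \<phi> k (\<gamma> b)\<bar> \<le> arc_integral (\<lambda>x. G x + G' x) \<gamma> a b + 0"
        if "0 \<le> a" "a < b" "b \<le> l" for k a b
        using that f f' by (auto simp: add \<phi>_def add_increasing add_increasing2)
      show "AE t in lborel. t \<in> {0..l} \<longrightarrow> (\<lambda>k. \<phi> k (\<gamma> t)) \<longlonglongrightarrow> f (\<gamma> t) \<and> \<bar>f (\<gamma> t)\<bar> \<noteq> \<infinity>"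
        using eq
      proof (rule eventually_mono, intro impI)
        fix t assume "t \<in> {0..l} \<longrightarrow> f (\<gamma> t) = f' (\<gamma> t) \<and> \<bar>f (\<gamma> t)\<bar> \<noteq> \<infinity>" "t \<in> {0..l}"
        then have "\<phi> k (\<gamma> t) = f (\<gamma> t)" "\<bar>f (\<gamma> t)\<bar> \<noteq> \<infinity>" for k
          by (auto simp: \<phi>_def)
        then show "(\<lambda>k. \<phi> k (\<gamma> t)) \<longlonglongrightarrow> f (\<gamma> t) \<and> \<bar>f (\<gamma> t)\<bar> \<noteq> \<infinity>" by simp
      qed
    qed (use t in auto)
    then obtain L where L: "(\<lambda>k. \<phi> k (\<gamma> t)) \<longlonglongrightarrow> L" by blast
    have "f (\<gamma> t) = L"
      using LIMSEQ_subseq_LIMSEQ[OF L, of "\<lambda>k. 2 * k"] by (simp add: \<phi>_def o_def strict_mono_def LIMSEQ_const_iff)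
    moreover have "f' (\<gamma> t) = L"
      using LIMSEQ_subseq_LIMSEQ[OF L, of "\<lambda>k. 2 * k + 1"] by (simp add: \<phi>_def o_def strict_mono_def LIMSEQ_const_iff)
    ultimately show "f (\<gamma> t) = f' (\<gamma> t)" by simp
  qed
qed

section \<open>Sets of capacity zero\<close>

text \<open>The indicator of \<open>E\<close> has norm zero, and all positive multiples of a witness \<open>\<rho>\<close> for the exceptional
  curves are upper gradients of it.\<close>

lemma capacity_zero_if_avoided:
  assumes E: "E \<in> null_sets M" and avoid: "almost_every_curve N (\<lambda>(l, \<gamma>). \<forall>t\<in>{0..l}. \<gamma> t \<notin> E)"
  shows "Sobolev_capacity M N E = 0"
proof -
  obtain \<rho> where \<rho>: "\<rho> \<in> borel_measurable borel" "nrm \<rho> < top"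
    "\<And>l \<gamma>. (l, \<gamma>) \<in> curves \<Longrightarrow> arc_integral \<rho> \<gamma> 0 l < top \<Longrightarrow> \<forall>t\<in>{0..l}. \<gamma> t \<notin> E"
    using almost_every_curveE[OF avoid] by auto
  let ?u = "indicator E :: 'a \<Rightarrow> ereal"
  let ?\<rho> = "\<lambda>n x. ennreal (inverse (Suc n)) * \<rho> x"
  have u: "?u \<in> borel_measurable M" using E by auto
  have Nu: "N ?u = 0"
    using AE_not_in[OF E] by (subst zero_iff[OF u]) (auto elim!: eventually_mono)
  \<comment> \<open>A curve that meets \<open>E\<close> has infinite \<open>\<rho>\<close>-integral; along the others the indicator vanishes.\<close>
  have ug: "upper_gradient (\<lambda>x. enn2ereal (?\<rho> n x)) ?u" for n
  proof -
    have "gradient_inequality (\<lambda>x. enn2ereal (?\<rho> n x)) ?u (l, \<gamma>)" if \<gamma>: "(l, \<gamma>) \<in> curves" for l \<gamma>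
    proof (cases "arc_integral \<rho> \<gamma> 0 l < top")
      case True
      then have "\<forall>t\<in>{0..l}. \<gamma> t \<notin> E" using \<rho>(3)[OF \<gamma>] by blast
      then show ?thesis
        using curves_pos[OF \<gamma>] by (simp add: gradient_inequality_def e2ennreal_neg)
    next
      case False
      then show ?thesis
        using arc_integral_cmult[OF \<rho>(1) curves_continuous[OF \<gamma>], of 0 l "ennreal (inverse (Suc n))"]
        by (simp add: gradient_inequality_def curve_integral_eq_arc_integral less_top[symmetric] ennreal_mult_top)
    qed
    moreover have "(\<lambda>x. enn2ereal (?\<rho> n x)) \<in> borel_measurable borel"
      using \<rho>(1) by measurable
    ultimately show ?thesis by (auto simp: upper_gradient_def)
  qed
  have nrm: "nrm (?\<rho> n) < top" for n
    using nrm_cmult[OF borel_measurable_imp_M[OF \<rho>(1)], of "inverse (Suc n)"] \<rho>(2)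
    by (simp add: ennreal_mult_less_top)
  have "(\<lambda>x. enn2ereal (?\<rho> 0 x)) \<in> X_space M N"
    using ug[of 0] nrm[of 0] unfolding X_space_def nrm_def upper_gradient_def
    by (auto intro: borel_measurable_imp_M)
  then have "?u \<in> Newtonian_space M N"
    using u Nu ug[of 0] by (auto simp: Newtonian_space_def Dirichlet_space_def X_space_def)
  then have "Newtonian_norm M N ?u \<le> nrm (?\<rho> n)" for n
    using ug[of n] by (auto simp: Newtonian_norm_def Nu nrm_def intro!: Inf_lower)
  moreover have "Sobolev_capacity M N E \<le> Newtonian_norm M N ?u"
    unfolding Sobolev_capacity_def using u by (intro Inf_lower) auto
  ultimately have "Sobolev_capacity M N E \<le> nrm (?\<rho> n)" for n
    by (meson order_trans)
  moreover have "(\<lambda>n. nrm (?\<rho> n)) \<longlonglongrightarrow> 0"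
    using \<rho> by (intro nrm_rescaled_tendsto_0 borel_measurable_imp_M)
  ultimately have "Sobolev_capacity M N E \<le> 0"
    by (intro LIMSEQ_le_const) auto
  then show ?thesis by simp
qed

text \<open>Admissible functions for \<open>E\<close> with vanishing Newtonian norm, together with their upper gradients,
  satisfy the assumptions of \<open>limit_along_almost_every_curve\<close> with limits 0 and 0. Their limit
  along almost every curve is then the constant 0, whereas it is at least 1 on \<open>E\<close>.\<close>

lemma avoided_if_capacity_zero:
  assumes "Sobolev_capacity M N E = 0"
  shows "almost_every_curve N (\<lambda>(l, \<gamma>). \<forall>t\<in>{0..l}. \<gamma> t \<notin> E)"
proof -
  have "\<exists>p. fst p \<in> borel_measurable M \<and> (\<forall>x\<in>E. 1 \<le> fst p x) \<and> upper_gradient (snd p) (fst p) \<and>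
    N (fst p) < ennreal (inverse (Suc n)) \<and> N (snd p) < ennreal (inverse (Suc n))" for n
  proof -
    have "Sobolev_capacity M N E < ennreal (inverse (Suc n))"
      using assms by simp
    then obtain u where u: "u \<in> borel_measurable M" "\<forall>x\<in>E. 1 \<le> u x"
      "Newtonian_norm M N u < ennreal (inverse (Suc n))"
      unfolding Sobolev_capacity_def Inf_less_iff by auto
    then have lt: "N u + Inf {N g | g. upper_gradient g u} < ennreal (inverse (Suc n))"
      by (auto simp: Newtonian_norm_def split: if_splits)
    then have "Inf {N g | g. upper_gradient g u} < ennreal (inverse (Suc n))"
      by (rule le_less_trans[rotated]) simp
    then obtain g where "upper_gradient g u" "N g < ennreal (inverse (Suc n))"
      unfolding Inf_less_iff by auto
    moreover have "N u < ennreal (inverse (Suc n))"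
      using lt by (rule le_less_trans[rotated]) simp
    ultimately show ?thesis
      using u by (intro exI[of _ "(u, g)"]) auto
  qed
  then obtain p where p: "\<And>n. fst (p n) \<in> borel_measurable M" "\<And>n x. x \<in> E \<Longrightarrow> 1 \<le> fst (p n) x"
    "\<And>n. upper_gradient (snd (p n)) (fst (p n))"
    "\<And>n. N (fst (p n)) < ennreal (inverse (Suc n))" "\<And>n. N (snd (p n)) < ennreal (inverse (Suc n))"
    by metis
  have lim: "q \<longlonglongrightarrow> 0" if "\<And>n. q n < ennreal (inverse (Suc n))" for q :: "nat \<Rightarrow> ennreal"
  proof (rule tendsto_sandwich[OF _ _ tendsto_const])
    show "(\<lambda>n. ennreal (inverse (Suc n))) \<longlonglongrightarrow> 0"
      using tendsto_ennrealI[OF LIMSEQ_inverse_real_of_nat] by simp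
  qed (use that in \<open>auto intro!: always_eventually less_imp_le\<close>)
  have zero: "(\<lambda>_. 0) \<in> X_space M N"
    using zero_iff[of "\<lambda>_. 0"] by (simp add: X_space_def)
  obtain r :: "nat \<Rightarrow> nat" where r: "strict_mono r" "AE x in M. (\<lambda>j. fst (p (r j)) x) \<longlonglongrightarrow> 0"
    "weak_upper_gradient M N (\<lambda>_. 0) (\<lambda>x. limsup (\<lambda>j. fst (p (r j)) x))"
    "almost_every_curve N (\<lambda>(l, \<gamma>). \<forall>t\<in>{0..l}.
      (\<lambda>j. fst (p (r j)) (\<gamma> t)) \<longlonglongrightarrow> limsup (\<lambda>j. fst (p (r j)) (\<gamma> t)))"
  proof (rule limit_along_almost_every_curve[of "\<lambda>n. fst (p n)" "\<lambda>n. snd (p n)" "\<lambda>_. 0" "\<lambda>_. 0"])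
    show "weak_upper_gradient M N (snd (p k)) (fst (p k))" for k
      using p(3) by (rule upper_gradient_imp_weak)
  qed (use p zero lim in \<open>auto simp: tendsto_in_X_def\<close>)
  let ?u = "\<lambda>x. limsup (\<lambda>j. fst (p (r j)) x)"
  have "almost_every_curve N (\<lambda>(l, \<gamma>). e2ennreal \<bar>?u (\<gamma> 0) - ?u (\<gamma> l)\<bar> \<le> arc_integral (\<lambda>_. 0) \<gamma> 0 l)"
    using r(3) unfolding weak_upper_gradient_def
    by (auto elim!: almost_every_curve_mono simp: gradient_inequality_def curve_integral_eq_arc_integral e2ennreal_neg)
  then have sub: "almost_every_curve N (\<lambda>(l, \<gamma>). \<forall>a b. 0 \<le> a \<longrightarrow> a < b \<longrightarrow> b \<le> l \<longrightarrow>
      e2ennreal \<bar>?u (\<gamma> a) - ?u (\<gamma> b)\<bar> \<le> arc_integral (\<lambda>_. 0) \<gamma> a b)"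
    by (intro gradient_bound_on_subcurves) auto
  show ?thesis
    using almost_every_curve_conj[OF almost_every_curve_AE[OF r(2)] sub]
  proof (rule almost_every_curve_mono, unfold split_conv, elim conjE, intro ballI notI)
    fix l t and \<gamma> :: "real \<Rightarrow> 'a"
    assume \<gamma>: "(l, \<gamma>) \<in> curves"
      and conv: "AE t in lborel. t \<in> {0..l} \<longrightarrow> (\<lambda>j. fst (p (r j)) (\<gamma> t)) \<longlonglongrightarrow> 0"
      and const: "\<forall>a b. 0 \<le> a \<longrightarrow> a < b \<longrightarrow> b \<le> l \<longrightarrow>
        e2ennreal \<bar>?u (\<gamma> a) - ?u (\<gamma> b)\<bar> \<le> arc_integral (\<lambda>_. 0) \<gamma> a b"
      and t: "t \<in> {0..l}" "\<gamma> t \<in> E"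
    \<comment> \<open>\<open>?u\<close> is constant along the curve and vanishes somewhere on it.\<close>
    obtain s where s: "s \<in> {0<..<l}" "(\<lambda>j. fst (p (r j)) (\<gamma> s)) \<longlonglongrightarrow> 0"
      using AE_ex_in_interval[OF conv, of 0 l] curves_pos[OF \<gamma>] by auto
    have us: "?u (\<gamma> s) = 0"
      using s(2) by (intro lim_imp_Limsup) auto
    have eq0: "x = 0" if "e2ennreal \<bar>x\<bar> \<le> arc_integral (\<lambda>_. 0) \<gamma> a b" for x a b
    proof -
      have "e2ennreal \<bar>x\<bar> = 0"
        using that by (simp add: arc_integral_def)
      then show ?thesis by (cases x) auto
    qed
    have "?u (\<gamma> t) = 0"
    proof (cases s t rule: linorder_cases)
      case less
      then show ?thesis using eq0[OF const[rule_format, of s t]] s(1) t(1) us by simp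
    next
      case greater
      then show ?thesis using eq0[OF const[rule_format, of t s]] s(1) t(1) us by simp
    qed (use us in simp)
    moreover have "1 \<le> ?u (\<gamma> t)"
      using p(2)[OF t(2)] by (intro le_Limsup) auto
    ultimately show False by simp
  qed
qed

end

lemma sets_tendsto_ereal:
  fixes F :: "nat \<Rightarrow> 'a \<Rightarrow> ereal"
  assumes [measurable]: "\<And>j. F j \<in> borel_measurable M" "h \<in> borel_measurable M"
  shows "{x \<in> space M. (\<lambda>j. F j x) \<longlonglongrightarrow> h x} \<in> sets M"
proof -
  have "{x \<in> space M. (\<lambda>j. F j x) \<longlonglongrightarrow> h x} =
    {x \<in> space M. liminf (\<lambda>j. F j x) = h x \<and> limsup (\<lambda>j. F j x) = h x}"
    by (auto simp: tendsto_iff_Liminf_eq_Limsup)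
  also have "\<dots> \<in> sets M" by measurable
  finally show ?thesis .
qed

context quasi_Banach_function_lattice
begin

lemma quasi_everywhere_tendsto:
  fixes h :: "'a \<Rightarrow> ereal"
  assumes "\<And>j. F j \<in> borel_measurable M" "h \<in> borel_measurable M"
    "AE x in M. (\<lambda>j. F j x) \<longlonglongrightarrow> h x"
    "almost_every_curve N (\<lambda>(l, \<gamma>). \<forall>t\<in>{0..l}. (\<lambda>j. F j (\<gamma> t)) \<longlonglongrightarrow> h (\<gamma> t))"
  shows "quasi_everywhere M N (\<lambda>x. (\<lambda>j. F j x) \<longlonglongrightarrow> h x)"
  unfolding quasi_everywhere_def
proof (rule capacity_zero_if_avoided)
  have "space M - {x \<in> space M. (\<lambda>j. F j x) \<longlonglongrightarrow> h x} \<in> sets M"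
    using sets_tendsto_ereal[OF assms(1,2)] by auto
  moreover have "space M - {x \<in> space M. (\<lambda>j. F j x) \<longlonglongrightarrow> h x} = {x. \<not> (\<lambda>j. F j x) \<longlonglongrightarrow> h x}"
    by (auto simp: space_eq)
  ultimately have "{x. \<not> (\<lambda>j. F j x) \<longlonglongrightarrow> h x} \<in> sets M" by simp
  then show "{x. \<not> (\<lambda>j. F j x) \<longlonglongrightarrow> h x} \<in> null_sets M"
    using assms(3) by (subst AE_iff_null_sets) auto
qed (use assms(4) in simp)

section \<open>The limit theorem\<close>

text \<open>Convergence is recorded both almost everywhere and along almost every curve: together the two give
  convergence quasi-everywhere, and the second one identifies the limit with other candidates.\<close>

lemma limit_representative:
  assumes fs: "\<And>k. fs k \<in> borel_measurable M"
    and ug: "\<And>k. weak_upper_gradient M N (gs k) (fs k)"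
    and f: "tendsto_in_X M N fs f" and g: "tendsto_in_X M N gs g" "\<And>x. 0 \<le> g x"
  obtains f' and r :: "nat \<Rightarrow> nat" where "strict_mono r" "AE x in M. f' x = f x"
    "weak_upper_gradient M N g f'" "f' \<in> Newtonian_space M N"
    "AE x in M. (\<lambda>j. fs (r j) x) \<longlonglongrightarrow> f' x"
    "almost_every_curve N (\<lambda>(l, \<gamma>). \<forall>t\<in>{0..l}. (\<lambda>j. fs (r j) (\<gamma> t)) \<longlonglongrightarrow> f' (\<gamma> t))"
proof -
  obtain r :: "nat \<Rightarrow> nat" where r: "strict_mono r" "AE x in M. (\<lambda>j. fs (r j) x) \<longlonglongrightarrow> f x"
    "weak_upper_gradient M N g (\<lambda>x. limsup (\<lambda>j. fs (r j) x))"
    "almost_every_curve N (\<lambda>(l, \<gamma>). \<forall>t\<in>{0..l}. (\<lambda>j. fs (r j) (\<gamma> t)) \<longlonglongrightarrow> limsup (\<lambda>j. fs (r j) (\<gamma> t)))"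
    using limit_along_almost_every_curve[OF fs ug f g] by blast
  define f' where "f' x = limsup (\<lambda>j. fs (r j) x)" for x
  have eq: "AE x in M. f' x = f x"
    using r(2) by eventually_elim (auto simp: f'_def intro: lim_imp_Limsup)
  have f': "f' \<in> borel_measurable M"
    unfolding f'_def using fs by measurable
  have fX: "f \<in> borel_measurable M" "N f < top" and Ng: "N g < top"
    using f g by (auto simp: tendsto_in_X_def X_space_def)
  have "N f' \<le> N f"
    using eq by (intro lattice f' fX) auto
  then have "f' \<in> X_space M N"
    using f' fX(2) by (auto simp: X_space_def)
  then have "f' \<in> Newtonian_space M N"
    using r(3) Ng unfolding f'_def by (rule Newtonian_if_weak_upper_gradient)
  moreover have "AE x in M. (\<lambda>j. fs (r j) x) \<longlonglongrightarrow> f' x"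
    using r(2) eq by eventually_elim simp
  ultimately show thesis
    using that[OF r(1) eq] r(3,4) by (simp add: f'_def[abs_def])
qed

end

theorem proposition5p5:
  fixes M :: "'a::metric_space measure"
    and N :: "('a \<Rightarrow> ereal) \<Rightarrow> ennreal"
    and c :: real
    and fs gs :: "nat \<Rightarrow> 'a \<Rightarrow> ereal"
    and f g :: "'a \<Rightarrow> ereal"
  assumes "quasi_Banach_function_lattice M N c"
    and "continuous_quasi_norm M N"
    and "\<And>k. fs k \<in> Newtonian_space M N"
    and "\<And>k. gs k \<in> X_space M N"
    and "\<And>k. weak_upper_gradient M N (gs k) (fs k)"
    and "tendsto_in_X M N fs f"
    and "tendsto_in_X M N gs g"
    and "\<And>x. 0 \<le> g x"
  shows "(\<exists>f'. (AE x in M. f' x = f x) \<and> weak_upper_gradient M N g f' \<and>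
            f' \<in> Newtonian_space M N \<and> subsequence_tendsto_qe M N fs f') \<and>
         (f \<in> Newtonian_space M N \<or> subsequence_tendsto_qe M N fs f \<longrightarrow>
            weak_upper_gradient M N g f \<and> f \<in> Newtonian_space M N \<and>
            subsequence_tendsto_qe M N fs f)"
proof -
  interpret quasi_Banach_function_lattice M N c by fact
  have fs: "\<And>k. fs k \<in> borel_measurable M"
    using assms(3) by (simp add: Newtonian_space_def X_space_def)
  note ug = assms(5) and f = assms(6) and g = assms(7,8)
  show ?thesis
  proof (intro conjI[of "\<exists>f'. _ f'"] impI)
    have fX: "f \<in> X_space M N" and Ng: "N g < top"
      using f g by (auto simp: tendsto_in_X_def X_space_def)
    obtain f' and r :: "nat \<Rightarrow> nat" where r: "strict_mono r" and eq: "AE x in M. f' x = f x"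
      and ug': "weak_upper_gradient M N g f'" and f': "f' \<in> Newtonian_space M N"
      and AE: "AE x in M. (\<lambda>j. fs (r j) x) \<longlonglongrightarrow> f' x"
      and ae: "almost_every_curve N (\<lambda>(l, \<gamma>). \<forall>t\<in>{0..l}. (\<lambda>j. fs (r j) (\<gamma> t)) \<longlonglongrightarrow> f' (\<gamma> t))"
      using limit_representative[OF fs ug f g] by blast
    have "quasi_everywhere M N (\<lambda>x. (\<lambda>j. fs (r j) x) \<longlonglongrightarrow> f' x)"
      using f' AE ae by (intro quasi_everywhere_tendsto fs) (auto simp: Newtonian_space_def X_space_def)
    then show "\<exists>f'. (AE x in M. f' x = f x) \<and> weak_upper_gradient M N g f' \<and>
              f' \<in> Newtonian_space M N \<and> subsequence_tendsto_qe M N fs f'"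
      using r eq ug' f' unfolding subsequence_tendsto_qe_def by blast
    assume "f \<in> Newtonian_space M N \<or> subsequence_tendsto_qe M N fs f"
    then show "weak_upper_gradient M N g f \<and> f \<in> Newtonian_space M N \<and> subsequence_tendsto_qe M N fs f"
    proof
      assume fN: "f \<in> Newtonian_space M N"
      have eq': "AE x in M. f x = f' x" using eq by eventually_elim simp
      have same: "almost_every_curve N (\<lambda>(l, \<gamma>). \<forall>t\<in>{0..l}. f (\<gamma> t) = f' (\<gamma> t))"
        using fN f' eq' by (rule Newtonian_AE_eq_imp_eq_along_curves)
      have "quasi_everywhere M N (\<lambda>x. (\<lambda>j. fs (r j) x) \<longlonglongrightarrow> f x)"
      proof (rule quasi_everywhere_tendsto)
        show "AE x in M. (\<lambda>j. fs (r j) x) \<longlonglongrightarrow> f x"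
          using AE eq by eventually_elim simp
        show "almost_every_curve N (\<lambda>(l, \<gamma>). \<forall>t\<in>{0..l}. (\<lambda>j. fs (r j) (\<gamma> t)) \<longlonglongrightarrow> f (\<gamma> t))"
          using almost_every_curve_conj[OF ae same] by (rule almost_every_curve_mono) auto
      qed (use fs fX in \<open>auto simp: X_space_def\<close>)
      then have "subsequence_tendsto_qe M N fs f"
        using r unfolding subsequence_tendsto_qe_def by blast
      then show ?thesis
        using fN weak_upper_gradient_cong[OF ug' same] by blast
    next
      assume qe: "subsequence_tendsto_qe M N fs f"
      then obtain q :: "nat \<Rightarrow> nat" where q: "strict_mono q"
        and cap: "Sobolev_capacity M N {x. \<not> (\<lambda>j. fs (q j) x) \<longlonglongrightarrow> f x} = 0"
        unfolding subsequence_tendsto_qe_def quasi_everywhere_def by blast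
      have "tendsto_in_X M N (\<lambda>j. fs (q j)) f" "tendsto_in_X M N (\<lambda>j. gs (q j)) g"
        using f g q by (auto simp: tendsto_in_X_def dest: LIMSEQ_subseq_LIMSEQ simp: o_def)
      then obtain h and s :: "nat \<Rightarrow> nat" where s: "strict_mono s"
        and h: "weak_upper_gradient M N g h"
        and conv: "almost_every_curve N (\<lambda>(l, \<gamma>). \<forall>t\<in>{0..l}. (\<lambda>j. fs (q (s j)) (\<gamma> t)) \<longlonglongrightarrow> h (\<gamma> t))"
        using limit_representative[of "\<lambda>j. fs (q j)" "\<lambda>j. gs (q j)" f g, OF fs ug _ _ g(2)] by blast
      \<comment> \<open>Along a curve both limits exist at every point, and the second one is taken along a subsequence.\<close>
      have same: "almost_every_curve N (\<lambda>(l, \<gamma>). \<forall>t\<in>{0..l}. f (\<gamma> t) = h (\<gamma> t))"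
        using almost_every_curve_conj[OF avoided_if_capacity_zero[OF cap] conv]
      proof (rule almost_every_curve_mono, unfold split_conv, elim conjE, intro ballI)
        fix l t and \<gamma> :: "real \<Rightarrow> 'a"
        assume "\<forall>t\<in>{0..l}. \<gamma> t \<notin> {x. \<not> (\<lambda>j. fs (q j) x) \<longlonglongrightarrow> f x}"
          "\<forall>t\<in>{0..l}. (\<lambda>j. fs (q (s j)) (\<gamma> t)) \<longlonglongrightarrow> h (\<gamma> t)" "t \<in> {0..l}"
        then have "(\<lambda>j. fs (q j) (\<gamma> t)) \<longlonglongrightarrow> f (\<gamma> t)" "(\<lambda>j. fs (q (s j)) (\<gamma> t)) \<longlonglongrightarrow> h (\<gamma> t)"
          by auto
        then show "f (\<gamma> t) = h (\<gamma> t)"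
          using LIMSEQ_subseq_LIMSEQ[OF _ s, of "\<lambda>j. fs (q j) (\<gamma> t)" "f (\<gamma> t)"]
          by (auto simp: o_def intro: LIMSEQ_unique)
      qed
      have "weak_upper_gradient M N g f"
        using h same by (rule weak_upper_gradient_cong)
      then show ?thesis
        using qe Newtonian_if_weak_upper_gradient[OF fX _ Ng] by blast
    qed
  qed
qed

end
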